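(* Let $X$ be a regular (Hausdorff) space. First, if $X$ is infinite, the following are equivalent: (i) $X$ is $\omega$-Rothberger. (ii) $X^{<\omega}$ is Rothberger, where $X^{<\omega}$ is the disjoint union of $X^n$ for all $n \geq 1$. (iii) $\mathcal{P}_{\mathrm{fin}}(X)$ is Rothberger, where $\mathcal{P}_{\mathrm{fin}}(X)$ is the set of non-empty finite subsets of $X$ with the subspace topology inherited from $\mathbb K(X)$. (iv) $\mathrm{I} \not\uparrow \mathsf G_1(\Omega_X , \Omega_X)$. (v) $\mathrm{MC}_p(X)$ has strong countable fan-tightness at $\mathbf 0$. (vi) $\mathrm{MC}_p(X)$ has strong countable dense fan-tightness at $\mathbf 0$. (vii) $\mathrm{II} \not\uparrow_{\mathrm{mark}} \mathsf G_1(\mathscr N_X[[X]^{<\omega}], \neg \Omega_X)$. (viii) $\mathrm{II} \not\uparrow \mathsf G_1(\mathscr N_X[[X]^{<\omega}], \neg \Omega_X)$. (ix) $\mathrm{II} \not\uparrow_{\mathrm{mark}} \mathsf G_1(\mathscr T_{\mathrm{MC}_p(X)}, \mathrm{CD}_{\mathrm{MC}_p(X)})$. (x) $\mathrm{II} \not\uparrow \mathsf G_1(\mathscr T_{\mathrm{MC}_p(X)}, \mathrm{CD}_{\mathrm{MC}_p(X)})$. (xi) $\mathrm{II} \not\uparrow_{\mathrm{mark}} \mathsf G_1(\mathscr N_{\mathrm{MC}_p(X),\mathbf 0}, \neg \Omega_{\mathrm{MC}_p(X),\mathbf 0})$. (xii) $\mathrm{II} \not\uparrow \mathsf G_1(\mathscr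 N_{\mathrm{MC}_p(X),\mathbf 0}, \neg \Omega_{\mathrm{MC}_p(X),\mathbf 0})$. Also, if $X$ is non-compact, the following are equivalent: (i) $X$ is $k$-Rothberger. (ii) $\mathrm{I} \not\uparrow \mathsf G_1(\mathcal K_X , \mathcal K_X)$. (iii) $\mathrm{MC}_k(X)$ has strong countable fan-tightness at $\mathbf 0$. (iv) $\mathrm{MC}_k(X)$ has strong countable dense fan-tightness at $\mathbf 0$. (v) $\mathrm{II} \not\uparrow_{\mathrm{mark}} \mathsf G_1(\mathscr N_X[K(X)], \neg \mathcal K_X)$. (vi) $\mathrm{II} \not\uparrow \mathsf G_1(\mathscr N_X[K(X)], \neg \mathcal K_X)$. (vii) $\mathrm{II} \not\uparrow_{\mathrm{mark}} \mathsf G_1(\mathscr T_{\mathrm{MC}_k(X)}, \mathrm{CD}_{\mathrm{MC}_k(X)})$. (viii) $\mathrm{II} \not\uparrow \mathsf G_1(\mathscr T_{\mathrm{MC}_k(X)}, \mathrm{CD}_{\mathrm{MC}_k(X)})$. (ix) $\mathrm{II} \not\uparrow_{\mathrm{mark}} \mathsf G_1(\mathscr N_{\mathrm{MC}_k(X),\mathbf 0}, \neg \Omega_{\mathrm{MC}_k(X),\mathbf 0})$. (x) $\mathrm{II} \not\uparrow \mathsf G_1(\mathscr N_{\mathrm{MC}_k(X),\mathbf 0}, \neg \Omega_{\mathrm{MC}_k(X),\mathbf 0})$.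
   Context: Minimal cusco maps. A cusco map $\Phi$ from $X$ to $\mathbb R$ assigns to each $x\in X$ a non-empty compact convex set $\Phi(x)\subseteq\mathbb R$ and is upper semicontinuous: $\{x\in X:\Phi(x)\subseteq V\}$ is open for every open $V\subseteq\mathbb R$. It is minimal if its graph $\{\langle x,y\rangle:y\in\Phi(x)\}$ is $\subseteq$-minimal among graphs of cusco maps from $X$ to $\mathbb R$. $\mathrm{MC}(X)$ is the set of all minimal cusco maps from $X$ to $\mathbb R$; $\mathbf 0\in \mathrm{MC}(X)$ is the map constantly $\{0\}$. For $A\subseteq X$ and $\varepsilon>0$, $\mathbf W(A,\varepsilon)$ is the set of pairs $\langle\Phi,\Psi\rangle$ such that for all $x\in A$, $\Phi(x)\subseteq\bigcup_{y\in\Psi(x)}B(y,\varepsilon)$ and $\Psi(x)\subseteq\bigcup_{y\in\Phi(x)}B(y,\varepsilon)$, where $B(y,\varepsilon)=(y-\varepsilon,y+\varepsilon)$. For a family $\mathcal A$ of subsets of $X$, $\mathrm{MC}_{\mathcal A}(X)$ is $\mathrm{MC}(X)$ with the topology generated by the uniformity with base $\{\mathbf W(A,\varepsilon):A\in\mathcal A,\varepsilon>0\}$. $\mathrm{MC}_p(X)$ (resp. $\mathrm{MC}_k(X)$) is the case $\mathcal A=[X]^{<\omega}$ (resp. $\mathcal A=K(X)$), where $[X]^{<\omega}$ here denotes the family of non-empty finite subsets and $K(X)$ the family of non-empty compact subsets of $X$. $\mathbb K(X)$ is $K(X)$ with the Vietoris topology. Collections. $\mathcal O_X$ is the set of open covers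 $\mathscr U$ of $X$ with $\emptyset\notin\mathscr U$ and $X\notin\mathscr U$; $\Omega_X$ (resp. $\mathcal K_X$) is the set of $\mathscr U\in\mathcal O_X$ such that every finite (resp. compact) subset of $X$ is contained in some $U\in\mathscr U$. For a space $Y$ and $y\in Y$: $\mathscr T_Y$ is the set of all proper non-empty open subsets of $Y$; $\mathscr N_{Y,y}=\{U\in\mathscr T_Y:y\in U\}$; $\mathscr N_Y(A)=\{U\in\mathscr T_Y:A\subseteq U\}$ for $A\subseteq Y$, and $\mathscr N_Y[\mathcal A]=\{\mathscr N_Y(A):A\in\mathcal A\}$; $\Omega_{Y,y}=\{A\subseteq Y:y\in\mathrm{cl}_Y(A)\}$; $\mathscr D_Y$ is the set of dense subsets of $Y$; $\mathrm{CD}_Y$ is the set of closed and discrete subsets of $Y$. $\neg\mathcal D$ is the collection of sets not in $\mathcal D$. Selection principles. $\mathsf S_1(\mathcal C,\mathcal D)$ holds if for every sequence $\langle A_n:n\in\omega\rangle$ in $\mathcal C$ there are $x_n\in A_n$ with $\{x_n:n\in\omega\}\in\mathcal D$. A space $Y$ is Rothberger if $\mathsf S_1(\mathcal O_Y,\mathcal O_Y)$, $\omega$-Rothberger if $\mathsf S_1(\Omega_Y,\Omega_Y)$, $k$-Rothberger if $\mathsf S_1(\mathcal K_Y,\mathcal K_Y)$; it has strong countable fan-tightness at $y$ if $\mathsf S_1(\Omega_{Y,y},\Omega_{Y,y})$, and strong countable dense fan-tightness at $y$ if $\mathsf S_1(\mathscr D_Y,\Omega_{Y,y})$. Games. In $\mathsf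 G_1(\mathcal C,\mathcal D)$, in inning $n\in\omega$ One plays $A_n\in\mathcal C$ and Two responds with $x_n\in A_n$; Two wins if $\{x_n:n\in\omega\}\in\mathcal D$, otherwise One wins. $\mathrm I\uparrow\mathcal G$ (resp. $\mathrm{II}\uparrow\mathcal G$): One (resp. Two) has a winning strategy, where strategies may depend on all previous moves of the opponent (for Two, including the current one). $\mathrm{II}\uparrow_{\mathrm{mark}}\mathcal G$: Two has a winning Markov strategy, i.e. one depending only on One's current move and $n$. A slashed arrow denotes negation. *)

theory Defs
  imports "HOL-Analysis.Analysis"
begin

section \<open>Selection principles and games of length omega\<close>

definition S1 :: "'b set set \<Rightarrow> 'b set set \<Rightarrow> bool" where
  "S1 C D \<longleftrightarrow> (\<forall>A::nat \<Rightarrow> 'b set. (\<forall>n. A n \<in> C) \<longrightarrow>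
     (\<exists>x. (\<forall>n. x n \<in> A n) \<and> range x \<in> D))"

text \<open>
  A strategy for One maps the finite list of Two's previous moves to One's next move.
  A strategy for Two maps the non-empty list of One's moves so far (the current move is
  the last entry) to Two's response. A Markov strategy for Two sees only the current
  move of One and the number of the inning.
\<close>

definition winning_strategy_One ::
    "'b set set \<Rightarrow> 'b set set \<Rightarrow> ('b list \<Rightarrow> 'b set) \<Rightarrow> bool" where
  "winning_strategy_One C D \<sigma> \<longleftrightarrow>
     (\<forall>s. set s \<subseteq> \<Union>C \<longrightarrow> \<sigma> s \<in> C) \<and>
     (\<forall>x::nat \<Rightarrow> 'b. (\<forall>n. x n \<in> \<sigma> (map x [0..<n])) \<longrightarrow> range x \<notin> D)"

definition winning_strategy_Two ::
    "'b set set \<Rightarrow> 'b set set \<Rightarrow> ('b set list \<Rightarrow> 'b) \<Rightarrow> bool" where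
  "winning_strategy_Two C D \<tau> \<longleftrightarrow>
     (\<forall>s. s \<noteq> [] \<and> set s \<subseteq> C \<longrightarrow> \<tau> s \<in> last s) \<and>
     (\<forall>A::nat \<Rightarrow> 'b set. (\<forall>n. A n \<in> C) \<longrightarrow> range (\<lambda>n. \<tau> (map A [0..<Suc n])) \<in> D)"

definition winning_Markov_strategy_Two ::
    "'b set set \<Rightarrow> 'b set set \<Rightarrow> ('b set \<Rightarrow> nat \<Rightarrow> 'b) \<Rightarrow> bool" where
  "winning_Markov_strategy_Two C D \<tau> \<longleftrightarrow>
     (\<forall>A\<in>C. \<forall>n. \<tau> A n \<in> A) \<and>
     (\<forall>A::nat \<Rightarrow> 'b set. (\<forall>n. A n \<in> C) \<longrightarrow> range (\<lambda>n. \<tau> (A n) n) \<in> D)"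

definition One_wins_G1 :: "'b set set \<Rightarrow> 'b set set \<Rightarrow> bool" where
  "One_wins_G1 C D \<longleftrightarrow> (\<exists>\<sigma>. winning_strategy_One C D \<sigma>)"

definition Two_wins_G1 :: "'b set set \<Rightarrow> 'b set set \<Rightarrow> bool" where
  "Two_wins_G1 C D \<longleftrightarrow> (\<exists>\<tau>. winning_strategy_Two C D \<tau>)"

definition Two_wins_G1_Markov :: "'b set set \<Rightarrow> 'b set set \<Rightarrow> bool" where
  "Two_wins_G1_Markov C D \<longleftrightarrow> (\<exists>\<tau>. winning_Markov_strategy_Two C D \<tau>)"


section \<open>Collections attached to a space\<close>

definition finite_sets :: "'a topology \<Rightarrow> 'a set set" where
  "finite_sets X = {F. F \<subseteq> topspace X \<and> finite F \<and> F \<noteq> {}}"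

definition compact_sets :: "'a topology \<Rightarrow> 'a set set" where
  "compact_sets X = {K. compactin X K \<and> K \<noteq> {}}"

definition open_covers :: "'a topology \<Rightarrow> 'a set set set" where
  "open_covers X = {\<U>. (\<forall>U\<in>\<U>. openin X U) \<and> \<Union>\<U> = topspace X \<and> {} \<notin> \<U> \<and> topspace X \<notin> \<U>}"

definition omega_covers :: "'a topology \<Rightarrow> 'a set set set" where
  "omega_covers X =
     {\<U> \<in> open_covers X. \<forall>F. F \<subseteq> topspace X \<and> finite F \<longrightarrow> (\<exists>U\<in>\<U>. F \<subseteq> U)}"

definition k_covers :: "'a topology \<Rightarrow> 'a set set set" where
  "k_covers X = {\<U> \<in> open_covers X. \<forall>K. compactin X K \<longrightarrow> (\<exists>U\<in>\<U>. K \<subseteq> U)}"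

definition proper_opens :: "'a topology \<Rightarrow> 'a set set" where
  "proper_opens Y = {U. openin Y U \<and> U \<noteq> {} \<and> U \<noteq> topspace Y}"

definition nhds_pt :: "'a topology \<Rightarrow> 'a \<Rightarrow> 'a set set" where
  "nhds_pt Y y = {U \<in> proper_opens Y. y \<in> U}"

definition nhds_set :: "'a topology \<Rightarrow> 'a set \<Rightarrow> 'a set set" where
  "nhds_set Y A = {U \<in> proper_opens Y. A \<subseteq> U}"

definition clustering_sets :: "'a topology \<Rightarrow> 'a \<Rightarrow> 'a set set" where
  "clustering_sets Y y = {A. A \<subseteq> topspace Y \<and> y \<in> Y closure_of A}"

definition dense_sets :: "'a topology \<Rightarrow> 'a set set" where
  "dense_sets Y = {A. A \<subseteq> topspace Y \<and> Y closure_of A = topspace Y}"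

definition closed_discrete_sets :: "'a topology \<Rightarrow> 'a set set" where
  "closed_discrete_sets Y = {A. closedin Y A \<and> subtopology Y A = discrete_topology A}"

definition Rothberger :: "'a topology \<Rightarrow> bool" where
  "Rothberger Y \<longleftrightarrow> S1 (open_covers Y) (open_covers Y)"

definition omega_Rothberger :: "'a topology \<Rightarrow> bool" where
  "omega_Rothberger Y \<longleftrightarrow> S1 (omega_covers Y) (omega_covers Y)"

definition k_Rothberger :: "'a topology \<Rightarrow> bool" where
  "k_Rothberger Y \<longleftrightarrow> S1 (k_covers Y) (k_covers Y)"

definition strong_countable_fan_tightness_at :: "'a topology \<Rightarrow> 'a \<Rightarrow> bool" where
  "strong_countable_fan_tightness_at Y y \<longleftrightarrow> S1 (clustering_sets Y y) (clustering_sets Y y)"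

definition strong_countable_dense_fan_tightness_at :: "'a topology \<Rightarrow> 'a \<Rightarrow> bool" where
  "strong_countable_dense_fan_tightness_at Y y \<longleftrightarrow> S1 (dense_sets Y) (clustering_sets Y y)"


section \<open>Finite powers and the Vietoris hyperspace\<close>

definition finite_powers :: "'a topology \<Rightarrow> (nat \<times> (nat \<Rightarrow> 'a)) topology" where
  "finite_powers X = sum_topology (\<lambda>n. product_topology (\<lambda>_. X) {..<n}) {1..}"

definition Vietoris :: "'a topology \<Rightarrow> 'a set topology" where
  "Vietoris X = topology_generated_by
     ({{K \<in> compact_sets X. K \<subseteq> U} |U. openin X U} \<union>
      {{K \<in> compact_sets X. K \<inter> U \<noteq> {}} |U. openin X U})"

lemma topspace_Vietoris: "topspace (Vietoris X) = compact_sets X"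
proof -
  have "compact_sets X \<in> {{K \<in> compact_sets X. K \<subseteq> U} |U. openin X U}"
    by (rule CollectI, rule exI[of _ "topspace X"])
       (auto simp: compact_sets_def dest: compactin_subset_topspace)
  then have "compact_sets X \<subseteq> topspace (Vietoris X)"
    unfolding Vietoris_def topology_generated_by_topspace by (intro Union_upper UnI1)
  moreover have "topspace (Vietoris X) \<subseteq> compact_sets X"
    unfolding Vietoris_def topology_generated_by_topspace by (rule Union_least) auto
  ultimately show ?thesis by (rule subset_antisym[rotated])
qed

definition P_fin :: "'a topology \<Rightarrow> 'a set topology" where
  "P_fin X = subtopology (Vietoris X) (finite_sets X)"


section \<open>Minimal cusco maps\<close>

text \<open>
  Set-valued maps on a space \<open>X\<close> are total functions; they are required to be
  \<^const>\<open>extensional\<close>, so that two maps are equal iff they agree on \<^term>\<open>topspace X\<close>.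
\<close>

definition cusco_map :: "'a topology \<Rightarrow> ('a \<Rightarrow> real set) \<Rightarrow> bool" where
  "cusco_map X \<Phi> \<longleftrightarrow>
     \<Phi> \<in> extensional (topspace X) \<and>
     (\<forall>x\<in>topspace X. \<Phi> x \<noteq> {} \<and> compact (\<Phi> x) \<and> convex (\<Phi> x)) \<and>
     (\<forall>V. open V \<longrightarrow> openin X {x \<in> topspace X. \<Phi> x \<subseteq> V})"

definition graph_on :: "'a topology \<Rightarrow> ('a \<Rightarrow> real set) \<Rightarrow> ('a \<times> real) set" where
  "graph_on X \<Phi> = {(x, y). x \<in> topspace X \<and> y \<in> \<Phi> x}"

definition MC :: "'a topology \<Rightarrow> ('a \<Rightarrow> real set) set" where
  "MC X = {\<Phi>. cusco_map X \<Phi> \<and>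
     (\<forall>\<Psi>. cusco_map X \<Psi> \<and> graph_on X \<Psi> \<subseteq> graph_on X \<Phi> \<longrightarrow> graph_on X \<Psi> = graph_on X \<Phi>)}"

definition zero_MC :: "'a topology \<Rightarrow> 'a \<Rightarrow> real set" where
  "zero_MC X = restrict (\<lambda>_. {0}) (topspace X)"

definition W_MC ::
    "'a topology \<Rightarrow> 'a set \<Rightarrow> real \<Rightarrow> (('a \<Rightarrow> real set) \<times> ('a \<Rightarrow> real set)) set" where
  "W_MC X A \<epsilon> = {(\<Phi>, \<Psi>). \<Phi> \<in> MC X \<and> \<Psi> \<in> MC X \<and>
     (\<forall>x\<in>A. \<Phi> x \<subseteq> (\<Union>y\<in>\<Psi> x. ball y \<epsilon>) \<and> \<Psi> x \<subseteq> (\<Union>y\<in>\<Phi> x. ball y \<epsilon>))}"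

lemma W_MC_mono:
  assumes "A \<subseteq> B" and "\<delta> \<le> \<epsilon>"
  shows "W_MC X B \<delta> \<subseteq> W_MC X A \<epsilon>"
proof -
  have *: "S \<subseteq> (\<Union>y\<in>T. ball y \<epsilon>)" if "S \<subseteq> (\<Union>y\<in>T. ball y \<delta>)" for S T :: "real set"
    using that by (rule subset_trans) (intro UN_mono subset_refl subset_ball assms)
  show ?thesis
  proof (intro subrelI)
    fix \<Phi> \<Psi> assume "(\<Phi>, \<Psi>) \<in> W_MC X B \<delta>"
    then have "\<Phi> \<in> MC X" "\<Psi> \<in> MC X"
      and "\<And>x. x \<in> A \<Longrightarrow> \<Phi> x \<subseteq> (\<Union>y\<in>\<Psi> x. ball y \<delta>) \<and> \<Psi> x \<subseteq> (\<Union>y\<in>\<Phi> x. ball y \<delta>)"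
      using subsetD[OF assms(1)] unfolding W_MC_def mem_Collect_eq prod.case by blast+
    then show "(\<Phi>, \<Psi>) \<in> W_MC X A \<epsilon>"
      unfolding W_MC_def mem_Collect_eq prod.case by (simp add: *)
  qed
qed

text \<open>
  The topology of the uniformity on \<open>M\<close> with base \<open>B\<close>: a set is open iff with each
  of its points it contains an entourage ball. This is a topology as soon as \<open>B\<close> is
  directed downwards, which is the case for the families used below.
\<close>

definition uniformity_base_topology :: "'b set \<Rightarrow> ('b \<times> 'b) set set \<Rightarrow> 'b topology" where
  "uniformity_base_topology M B =
     topology (\<lambda>U. U \<subseteq> M \<and> (\<forall>x\<in>U. \<exists>E\<in>B. {y \<in> M. (x, y) \<in> E} \<subseteq> U))"

lemma openin_uniformity_base_topology:
  assumes "\<And>E F. E \<in> B \<Longrightarrow> F \<in> B \<Longrightarrow> \<exists>G\<in>B. G \<subseteq> E \<inter> F"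
  shows "openin (uniformity_base_topology M B) U \<longleftrightarrow>
           U \<subseteq> M \<and> (\<forall>x\<in>U. \<exists>E\<in>B. {y \<in> M. (x, y) \<in> E} \<subseteq> U)"
proof -
  have "istopology (\<lambda>U. U \<subseteq> M \<and> (\<forall>x\<in>U. \<exists>E\<in>B. {y \<in> M. (x, y) \<in> E} \<subseteq> U))" (is "istopology ?P")
    unfolding istopology_def
  proof (intro conjI allI impI)
    fix S T assume S: "?P S" and T: "?P T"
    show "S \<inter> T \<subseteq> M" using S by blast
    show "\<forall>x\<in>S \<inter> T. \<exists>E\<in>B. {y \<in> M. (x, y) \<in> E} \<subseteq> S \<inter> T"
    proof
      fix x assume "x \<in> S \<inter> T"
      then obtain E F where "E \<in> B" "{y \<in> M. (x, y) \<in> E} \<subseteq> S" "F \<in> B" "{y \<in> M. (x, y) \<in> F} \<subseteq> T"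
        using S T by blast
      moreover from this assms obtain G where "G \<in> B" "G \<subseteq> E \<inter> F" by meson
      ultimately show "\<exists>E\<in>B. {y \<in> M. (x, y) \<in> E} \<subseteq> S \<inter> T" by blast
    qed
  next
    fix \<K> assume *: "\<forall>K\<in>\<K>. ?P K"
    show "\<Union>\<K> \<subseteq> M" using * by blast
    show "\<forall>x\<in>\<Union>\<K>. \<exists>E\<in>B. {y \<in> M. (x, y) \<in> E} \<subseteq> \<Union>\<K>"
    proof
      fix x assume "x \<in> \<Union>\<K>"
      then obtain K where "K \<in> \<K>" "x \<in> K" by blast
      with * obtain E where "E \<in> B" "{y \<in> M. (x, y) \<in> E} \<subseteq> K" by blast
      with \<open>K \<in> \<K>\<close> show "\<exists>E\<in>B. {y \<in> M. (x, y) \<in> E} \<subseteq> \<Union>\<K>" by blast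
    qed
  qed
  then show ?thesis
    by (simp add: uniformity_base_topology_def topology_inverse')
qed

definition MC_top :: "'a topology \<Rightarrow> 'a set set \<Rightarrow> ('a \<Rightarrow> real set) topology" where
  "MC_top X \<A> = uniformity_base_topology (MC X) {W_MC X A \<epsilon> |A \<epsilon>. A \<in> \<A> \<and> 0 < \<epsilon>}"

lemma openin_MC_top:
  assumes "\<And>A B. A \<in> \<A> \<Longrightarrow> B \<in> \<A> \<Longrightarrow> A \<union> B \<in> \<A>"
  shows "openin (MC_top X \<A>) U \<longleftrightarrow>
           U \<subseteq> MC X \<and> (\<forall>\<Phi>\<in>U. \<exists>A\<in>\<A>. \<exists>\<epsilon>>0. {\<Psi> \<in> MC X. (\<Phi>, \<Psi>) \<in> W_MC X A \<epsilon>} \<subseteq> U)"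
proof -
  let ?B = "{W_MC X A \<epsilon> |A \<epsilon>. A \<in> \<A> \<and> 0 < \<epsilon>}"
  have "\<exists>G\<in>?B. G \<subseteq> E \<inter> F" if EF: "E \<in> ?B" "F \<in> ?B" for E F
  proof -
    obtain A \<epsilon> B \<delta> where E: "E = W_MC X A \<epsilon>" "A \<in> \<A>" "0 < \<epsilon>" and F: "F = W_MC X B \<delta>" "B \<in> \<A>" "0 < \<delta>"
      using EF by blast
    have "W_MC X (A \<union> B) (min \<epsilon> \<delta>) \<in> ?B" 
      by (intro CollectI exI[of _ "A \<union> B"] exI[of _ "min \<epsilon> \<delta>"]) (use assms E F in simp)
    moreover have "W_MC X (A \<union> B) (min \<epsilon> \<delta>) \<subseteq> E \<inter> F"
      unfolding E(1) F(1) by (intro Int_greatest W_MC_mono) auto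
    ultimately show ?thesis by blast
  qed
  then have "openin (MC_top X \<A>) U \<longleftrightarrow>
      U \<subseteq> MC X \<and> (\<forall>\<Phi>\<in>U. \<exists>E\<in>?B. {\<Psi> \<in> MC X. (\<Phi>, \<Psi>) \<in> E} \<subseteq> U)"
    unfolding MC_top_def by (rule openin_uniformity_base_topology)
  moreover have "(\<exists>E\<in>?B. P E) \<longleftrightarrow> (\<exists>A\<in>\<A>. \<exists>\<epsilon>>0. P (W_MC X A \<epsilon>))" for P
    by blast
  ultimately show ?thesis by simp
qed

definition MC_p :: "'a topology \<Rightarrow> ('a \<Rightarrow> real set) topology" where
  "MC_p X = MC_top X (finite_sets X)"

definition MC_k :: "'a topology \<Rightarrow> ('a \<Rightarrow> real set) topology" where
  "MC_k X = MC_top X (compact_sets X)"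

lemma openin_MC_p:
  "openin (MC_p X) U \<longleftrightarrow>
     U \<subseteq> MC X \<and> (\<forall>\<Phi>\<in>U. \<exists>A\<in>finite_sets X. \<exists>\<epsilon>>0. {\<Psi> \<in> MC X. (\<Phi>, \<Psi>) \<in> W_MC X A \<epsilon>} \<subseteq> U)"
  unfolding MC_p_def by (rule openin_MC_top) (simp add: finite_sets_def)

lemma openin_MC_k:
  "openin (MC_k X) U \<longleftrightarrow>
     U \<subseteq> MC X \<and> (\<forall>\<Phi>\<in>U. \<exists>A\<in>compact_sets X. \<exists>\<epsilon>>0. {\<Psi> \<in> MC X. (\<Phi>, \<Psi>) \<in> W_MC X A \<epsilon>} \<subseteq> U)"
  unfolding MC_k_def by (rule openin_MC_top) (simp add: compact_sets_def compactin_Un)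

end

theory Submission imports Defs
begin

text \<open>
  Fix a family \<open>\<A>\<close> of non-empty compact sets that contains the singletons, is closed under
  binary unions and does not contain the whole space: the finite sets of an infinite space, or the compact sets
  of a non-compact space. Apart from the two conditions on finite powers and finite sets, both halves of the
  result are the same statement about \<open>\<A>\<close>-covers, which are the open covers in which every
  member of \<open>\<A>\<close> is contained in some member.

  An \<open>\<A>\<close>-cover of \<open>X\<close> amounts to an open cover of the space \<open>\<A>\<close>
  with the upper Vietoris topology: replace each member \<open>U\<close> by \<open>{A \<in> \<A>. A \<subseteq>
  U}\<close>. So the selection principle for \<open>\<A>\<close>-covers is the Rothberger property of that
  space. Pawlikowski's theorem then says that One cannot win the corresponding game even by adapting the covers
  to Two's answers. It is proved here as \<open>selects_covers_beats_game\<close>: for every tree of open covers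
  some branch covers every point infinitely often. Each way of playing against Two is such a tree, which gives
  all implications from the selection principle to the absence of winning strategies. Covering infinitely often
  is what makes the radii tend to zero in \<open>MC(X)\<close>, so that the functions chosen along the branch
  cluster at \<open>\<zero>\<close>.

  Conversely, if a sequence \<open>\<U>\<^sub>n\<close> of \<open>\<A>\<close>-covers admits no good selection,
  then in inning \<open>n\<close> Two can answer a set \<open>A \<in> \<A>\<close> by a member of
  \<open>\<U>\<^sub>n\<close> containing \<open>A\<close>, which is a Markov strategy. The function space
  version needs a supply of minimal cusco maps: for \<open>A \<subseteq> U\<close> with \<open>U\<close> open,
  every minimal cusco map can be changed into one that is the same on \<open>A\<close> and constantly
  \<open>{c}\<close> off \<open>U\<close> (\<open>MC_modify_off_open\<close>). Regularity is enough for this,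
  because a minimal cusco map may jump at the boundary of an open set. With \<open>c = 1\<close> off a member of
  \<open>\<U>\<^sub>n\<close> Two's maps cannot cluster at \<open>\<zero>\<close>; with \<open>c = n\<close>
  they form a locally finite set, hence closed and discrete.

  For finite powers, a finite subset of \<open>X\<close> has finitely many \<open>k\<close>-tuples, so finitely
  many members of covers of the powers suffice to contain a cube \<open>U\<^sup>k\<close> around it. Reserving
  infinitely many innings for each stage turns a selection of sets \<open>U\<close> into a selection for the
  powers. The finite sets are a continuous image of the tuples, and an \<open>\<omega>\<close>-cover of
  \<open>X\<close> induces an open cover of the hyperspace of finite sets, which closes the circle.
\<close>

section \<open>Selecting from sequences of open covers\<close>

text \<open>
  The Rothberger property for arbitrary open covers. In the games below a cover may contain the
  empty set or the whole space, for example because a function is already small everywhere.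
\<close>

definition selects_covers :: "'z topology \<Rightarrow> bool" where
  "selects_covers Z \<longleftrightarrow>
     (\<forall>\<U>::nat \<Rightarrow> 'z set set. (\<forall>n. (\<forall>U\<in>\<U> n. openin Z U) \<and> topspace Z \<subseteq> \<Union>(\<U> n)) \<longrightarrow>
        (\<exists>u. (\<forall>n. u n \<in> \<U> n) \<and> topspace Z \<subseteq> \<Union>(range u)))"

lemma selects_coversD:
  fixes U :: "nat \<Rightarrow> 'm \<Rightarrow> 'z set"
  assumes "selects_covers Z"
    and "\<And>n m. m \<in> M n \<Longrightarrow> openin Z (U n m)"
    and "\<And>n z. z \<in> topspace Z \<Longrightarrow> \<exists>m\<in>M n. z \<in> U n m"
  obtains e where "\<And>n. e n \<in> M n" "\<And>z. z \<in> topspace Z \<Longrightarrow> \<exists>n. z \<in> U n (e n)"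
proof -
  have "(\<forall>W\<in>U n ` M n. openin Z W) \<and> topspace Z \<subseteq> \<Union>(U n ` M n)" for n
    using assms(2,3) by fastforce
  then obtain u where u: "\<And>n. u n \<in> U n ` M n" "topspace Z \<subseteq> \<Union>(range u)"
    using assms(1)[unfolded selects_covers_def, rule_format, of "\<lambda>n. U n ` M n"] by auto
  then have "\<forall>n. \<exists>m. m \<in> M n \<and> u n = U n m" by blast
  then obtain e where "\<forall>n. e n \<in> M n \<and> u n = U n (e n)" by metis
  with u(2) that show ?thesis by blast
qed

text \<open>
  The innings split into infinitely many infinite blocks, the rows of the pairing function, and
  a selection that covers can be made within each block.
\<close>

lemma selects_covers_infinitely_often:
  fixes U :: "nat \<Rightarrow> 'm \<Rightarrow> 'z set"
  assumes Z: "selects_covers Z"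
    and op: "\<And>n m. m \<in> M n \<Longrightarrow> openin Z (U n m)"
    and cov: "\<And>n z. z \<in> topspace Z \<Longrightarrow> \<exists>m\<in>M n. z \<in> U n m"
  obtains e where "\<And>n. e n \<in> M n" "\<And>z. z \<in> topspace Z \<Longrightarrow> infinite {n. z \<in> U n (e n)}"
proof -
  have "\<exists>e. (\<forall>j. e j \<in> M (prod_encode (k, j))) \<and>
      (\<forall>z\<in>topspace Z. \<exists>j. z \<in> U (prod_encode (k, j)) (e j))" for k
    by (rule selects_coversD[OF Z, of "\<lambda>j. M (prod_encode (k, j))" "\<lambda>j. U (prod_encode (k, j))"])
       (use op cov in auto)
  then obtain e where e: "\<And>k j. e k j \<in> M (prod_encode (k, j))"
      "\<And>k z. z \<in> topspace Z \<Longrightarrow> \<exists>j. z \<in> U (prod_encode (k, j)) (e k j)"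
    by metis
  define e' where "e' n = e (fst (prod_decode n)) (snd (prod_decode n))" for n
  have e': "e' (prod_encode (k, j)) = e k j" for k j by (simp add: e'_def)
  have inM: "e' n \<in> M n" for n
    using e(1)[of "fst (prod_decode n)" "snd (prod_decode n)"] by (simp add: e'_def)
  have "infinite {n. z \<in> U n (e' n)}" if z: "z \<in> topspace Z" for z
  proof -
    obtain h where h: "\<And>k. z \<in> U (prod_encode (k, h k)) (e k (h k))" using e(2)[OF z] by metis
    have "inj (\<lambda>k. prod_encode (k, h k))" by (rule injI) simp
    then have "infinite (range (\<lambda>k. prod_encode (k, h k)))" by (rule range_inj_infinite)
    moreover have "range (\<lambda>k. prod_encode (k, h k)) \<subseteq> {n. z \<in> U n (e' n)}"
      using h e' by auto
    ultimately show ?thesis using infinite_super by blast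
  qed
  with inM that show ?thesis by blast
qed

text \<open>
  Selecting from a constant sequence of covers extracts a countable subcover.
\<close>

lemma selects_covers_Lindelof:
  assumes Z: "selects_covers Z"
    and op: "\<And>m. m \<in> M \<Longrightarrow> openin Z (U m)"
    and cov: "\<And>z. z \<in> topspace Z \<Longrightarrow> \<exists>m\<in>M. z \<in> U m"
  obtains e :: "nat \<Rightarrow> 'm" where "\<And>n. e n \<in> M" "\<And>z. z \<in> topspace Z \<Longrightarrow> \<exists>n. z \<in> U (e n)"
  by (rule selects_coversD[OF Z, of "\<lambda>_. M" "\<lambda>_. U"]) (use op cov in auto)

text \<open>
  Selecting one member of an increasing cover amounts to selecting finitely many members of a cover. For each
  \<open>k\<close> the selection is applied to the covers \<open>V n k\<close> with \<open>n \<ge> k\<close>, so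
  only finitely many selections are active in inning \<open>n\<close> and \<open>f n\<close> can dominate all of
  them.
\<close>

lemma selects_covers_Menger:
  fixes V :: "nat \<Rightarrow> nat \<Rightarrow> nat \<Rightarrow> 'z set"
  assumes Z: "selects_covers Z"
    and op: "\<And>n k m. openin Z (V n k m)"
    and mono: "\<And>n k m m'. m \<le> m' \<Longrightarrow> V n k m \<subseteq> V n k m'"
    and cov: "\<And>n k z. z \<in> topspace Z \<Longrightarrow> \<exists>m. z \<in> V n k m"
  obtains f where "strict_mono f" "\<And>n. 0 < f n"
    "\<And>z k. z \<in> topspace Z \<Longrightarrow> \<exists>n. z \<in> V n k (f n)"
proof -
  have "\<exists>e. \<forall>z\<in>topspace Z. \<exists>j. z \<in> V (k + j) k (e j)" for k
    by (rule selects_coversD[OF Z, of "\<lambda>_. UNIV" "\<lambda>j. V (k + j) k"]) (use op cov in auto)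
  then obtain e where e: "\<And>k z. z \<in> topspace Z \<Longrightarrow> \<exists>j. z \<in> V (k + j) k (e k j)" by metis
  define f where "f n = (\<Sum>i\<le>n. Suc (\<Sum>k\<le>i. e k (i - k)))" for n
  have "f n < f (Suc n)" for n by (simp add: f_def)
  then have "strict_mono f" by (rule strict_mono_Suc_iff[THEN iffD2, rule_format])
  moreover have "0 < f n" for n unfolding f_def by (rule sum_pos) auto
  moreover have "\<exists>n. z \<in> V n k (f n)" if z: "z \<in> topspace Z" for z k
  proof -
    obtain j where j: "z \<in> V (k + j) k (e k j)" using e z by blast
    have "e k (k + j - k) \<le> (\<Sum>i\<le>k + j. e i (k + j - i))"
      by (rule member_le_sum) auto
    also have "\<dots> \<le> Suc (\<Sum>i\<le>k + j. e i (k + j - i))" by simp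
    also have "\<dots> \<le> f (k + j)" unfolding f_def by (rule member_le_sum) auto
    finally have "e k j \<le> f (k + j)" by simp
    then show ?thesis using mono j by blast
  qed
  ultimately show ?thesis using that by blast
qed

text \<open>
  Greedy choice: the \<open>k\<close> earlier values cannot exhaust a set with more than \<open>k\<close> elements.
\<close>

lemma injective_choice:
  fixes I :: "nat \<Rightarrow> 'b set"
  assumes "\<And>k. finite (I k)" "\<And>k. k < card (I k)"
  obtains h :: "nat \<Rightarrow> 'b" where "inj h" "\<And>k. h k \<in> I k"
proof -
  have "\<exists>h::nat \<Rightarrow> 'b. \<forall>k. h k \<in> I k - h ` {..<k}"
  proof (rule dependent_wellorder_choice)
    fix r :: 'b and f g :: "nat \<Rightarrow> 'b" and k :: nat
    assume "\<And>y. y < k \<Longrightarrow> f y = g y"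
    then have "f ` {..<k} = g ` {..<k}" by auto
    then show "(r \<in> I k - f ` {..<k}) = (r \<in> I k - g ` {..<k})" by simp
  next
    fix k and f :: "nat \<Rightarrow> 'b"
    have "card (f ` {..<k}) \<le> k" using card_image_le[of "{..<k}" f] by simp
    then have "\<not> I k \<subseteq> f ` {..<k}"
      using assms(2)[of k] card_mono[of "f ` {..<k}" "I k"] by auto
    then show "\<exists>r. r \<in> I k - f ` {..<k}" by blast
  qed
  then obtain h where h: "\<And>k. h k \<in> I k - h ` {..<k}" by blast
  have "inj h"
  proof (rule linorder_injI)
    fix i k :: nat assume "i < k"
    then have "h i \<in> h ` {..<k}" by simp
    moreover have "h k \<notin> h ` {..<k}" using h[of k] by blast
    ultimately show "h i \<noteq> h k" by metis
  qed
  with h that show ?thesis by blast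
qed

text \<open>
  The intersections of \<open>k + 1\<close> members from different innings form a cover, because every point is
  covered in more than \<open>k\<close> innings. A selected intersection therefore offers \<open>k + 1\<close> innings, so
  the selected intersections can be assigned to different innings, and in the assigned inning
  the member that takes part in the intersection contains it.
\<close>

lemma selects_from_infinitely_often_covering:
  fixes W :: "nat \<Rightarrow> 'm \<Rightarrow> 'z set"
  assumes Z: "selects_covers Z"
    and ne: "\<And>n. M n \<noteq> {}"
    and op: "\<And>n m. m \<in> M n \<Longrightarrow> openin Z (W n m)"
    and cov: "\<And>z. z \<in> topspace Z \<Longrightarrow> infinite {n. \<exists>m\<in>M n. z \<in> W n m}"
  obtains e where "\<And>n. e n \<in> M n" "\<And>z. z \<in> topspace Z \<Longrightarrow> infinite {n. z \<in> W n (e n)}"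
proof -
  define P where "P k = {(I, w). finite I \<and> card I = Suc k \<and> (\<forall>n\<in>I. w n \<in> M n)}" for k :: nat
  define G where "G p = (\<Inter>n\<in>fst p. W n (snd p n))" for p
  have opG: "openin Z (G p)" if "p \<in> P k" for p k
    unfolding G_def using that by (intro openin_INT2) (auto simp: P_def intro: op)
  have covG: "\<exists>p\<in>P k. z \<in> G p" if z: "z \<in> topspace Z" for z k
  proof -
    obtain I where I: "I \<subseteq> {n. \<exists>m\<in>M n. z \<in> W n m}" "finite I" "card I = Suc k"
      using infinite_arbitrarily_large[OF cov[OF z], of "Suc k"] by blast
    then have "\<forall>n\<in>I. \<exists>m. m \<in> M n \<and> z \<in> W n m" by blast
    then obtain w where "\<forall>n\<in>I. w n \<in> M n \<and> z \<in> W n (w n)" by metis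
    with I have "(I, w) \<in> P k" "z \<in> G (I, w)" by (auto simp: P_def G_def)
    then show ?thesis by blast
  qed
  obtain p where p: "\<And>k. p k \<in> P k" "\<And>z. z \<in> topspace Z \<Longrightarrow> infinite {k. z \<in> G (p k)}"
    by (rule selects_covers_infinitely_often[OF Z, of P "\<lambda>_. G"]) (use opG covG in auto)
  define I w where "I k = fst (p k)" and "w k = snd (p k)" for k
  have Iw: "finite (I k)" "card (I k) = Suc k" "n \<in> I k \<Longrightarrow> w k n \<in> M n" for k n
    using p(1)[of k] by (auto simp: P_def I_def w_def)
  obtain h where h: "inj h" "\<And>k. h k \<in> I k"
    by (rule injective_choice[of I]) (use Iw in auto)
  define e where "e n = (if n \<in> range h then w (inv h n) n else SOME m. m \<in> M n)" for n
  have eh: "e (h k) = w k (h k)" for k using h(1) by (simp add: e_def)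
  have "e n \<in> M n" for n
  proof (cases "n \<in> range h")
    case True
    then show ?thesis using eh Iw(3) h(2) by fastforce
  next
    case False
    then show ?thesis using ne[of n] by (simp add: e_def some_in_eq)
  qed
  moreover have "infinite {n. z \<in> W n (e n)}" if z: "z \<in> topspace Z" for z
  proof -
    have "h ` {k. z \<in> G (p k)} \<subseteq> {n. z \<in> W n (e n)}"
      using h(2) by (auto simp: G_def eh I_def w_def)
    moreover have "infinite (h ` {k. z \<in> G (p k)})"
      using p(2)[OF z] h(1) by (metis finite_imageD inj_on_subset subset_UNIV)
    ultimately show ?thesis using infinite_super by blast
  qed
  ultimately show ?thesis using that by blast
qed

section \<open>Games against a space that selects covers\<close>

text \<open>
  Suppose that Two keeps the first \<open>t ! i\<close> sets in inning \<open>i\<close> instead of a single one. Then all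
  positions \<open>s\<close> that are pointwise below \<open>t\<close> remain possible, and a point counts as covered by
  the first \<open>m\<close> sets of the next inning if this happens in all these positions at once.
\<close>

definition meets_cover :: "(nat list \<Rightarrow> nat \<Rightarrow> 'z set) \<Rightarrow> nat list \<Rightarrow> nat \<Rightarrow> 'z set" where
  "meets_cover U t m = {z. \<forall>s. list_all2 (<) s t \<longrightarrow> (\<exists>j<m. z \<in> U s j)}"

text \<open>
  A point that has been covered stays covered, so that the sets grow along a play; this is
  what the diagonal argument below needs. The threshold \<open>k\<close> counts a covering only if more
  than \<open>k\<close> sets are kept in that inning. As an inning keeps finitely many sets, being covered for
  all \<open>k\<close> means being covered in infinitely many innings.
\<close>

definition covered_beyond :: "(nat list \<Rightarrow> nat \<Rightarrow> 'z set) \<Rightarrow> nat \<Rightarrow> nat list \<Rightarrow> nat \<Rightarrow> 'z set" where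
  "covered_beyond U k t m =
     {z. (k < m \<and> z \<in> meets_cover U t m) \<or>
         (\<exists>i<length t. k < t ! i \<and> z \<in> meets_cover U (take i t) (t ! i))}"

lemma finite_list_all2_less: "finite {s. list_all2 (<) s (t :: nat list)}"
proof (rule finite_subset)
  show "{s. list_all2 (<) s t} \<subseteq> {s. set s \<subseteq> {..<Max (insert 0 (set t))} \<and> length s = length t}"
  proof safe
    fix s x assume st: "list_all2 (<) s t" and "x \<in> set s"
    then obtain i where "i < length s" "x = s ! i" by (auto simp: in_set_conv_nth)
    then have "x < t ! i" "t ! i \<in> set t" using st by (auto simp: list_all2_conv_all_nth)
    then show "x < Max (insert 0 (set t))"
      by (meson List.finite_set Max_ge finite.insertI insertI2 order_less_le_trans)
  qed (auto dest: list_all2_lengthD)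
qed (simp add: finite_lists_length_eq)

lemma openin_Ball_finite:
  assumes "finite S" "\<And>s. s \<in> S \<Longrightarrow> openin Z {z \<in> topspace Z. P s z}"
  shows "openin Z {z \<in> topspace Z. \<forall>s\<in>S. P s z}"
  using assms
proof (induction S)
  case (insert a S)
  have "{z \<in> topspace Z. \<forall>s\<in>insert a S. P s z} =
      {z \<in> topspace Z. P a z} \<inter> {z \<in> topspace Z. \<forall>s\<in>S. P s z}" by auto
  with insert show ?case by (simp add: openin_Int)
qed simp

lemma openin_Bex:
  assumes "\<And>s. s \<in> S \<Longrightarrow> openin Z {z \<in> topspace Z. P s z}"
  shows "openin Z {z \<in> topspace Z. \<exists>s\<in>S. P s z}"
proof -
  have "{z \<in> topspace Z. \<exists>s\<in>S. P s z} = (\<Union>s\<in>S. {z \<in> topspace Z. P s z})" by auto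
  with assms show ?thesis by auto
qed

lemma openin_meets_cover:
  assumes op: "\<And>s j. openin Z (U s j)"
  shows "openin Z {z \<in> topspace Z. z \<in> meets_cover U t m}"
proof -
  have "openin Z {z \<in> topspace Z. z \<in> U s j}" for s j
  proof -
    have "{z \<in> topspace Z. z \<in> U s j} = U s j" using openin_subset[OF op] by blast
    with op show ?thesis by simp
  qed
  then have "openin Z {z \<in> topspace Z. \<exists>j\<in>{..<m}. z \<in> U s j}" for s
    by (intro openin_Bex)
  then have "openin Z {z \<in> topspace Z. \<forall>s\<in>{s. list_all2 (<) s t}. \<exists>j\<in>{..<m}. z \<in> U s j}"
    by (intro openin_Ball_finite finite_list_all2_less)
  then show ?thesis by (simp add: meets_cover_def lessThan_def Bex_def)
qed

lemma openin_covered_beyond: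
  assumes op: "\<And>s j. openin Z (U s j)"
  shows "openin Z {z \<in> topspace Z. z \<in> covered_beyond U k t m}"
proof -
  let ?I = "{i. i < length t \<and> k < t ! i}"
  have "{z \<in> topspace Z. z \<in> covered_beyond U k t m} =
    (if k < m then {z \<in> topspace Z. z \<in> meets_cover U t m} else {}) \<union>
    {z \<in> topspace Z. \<exists>i\<in>?I. z \<in> meets_cover U (take i t) (t ! i)}"
    by (auto simp: covered_beyond_def)
  moreover have "openin Z \<dots>"
    using op by (intro openin_Un openin_Bex) (auto intro!: openin_meets_cover)
  ultimately show ?thesis by simp
qed

lemma covered_beyond_mono: "m \<le> m' \<Longrightarrow> covered_beyond U k t m \<subseteq> covered_beyond U k t m'"
  by (force simp: covered_beyond_def meets_cover_def)

lemma covered_beyond_take: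
  assumes "i < length t"
  shows "covered_beyond U k (take i t) (t ! i) \<subseteq> covered_beyond U k t m"
proof
  fix z assume "z \<in> covered_beyond U k (take i t) (t ! i)"
  then consider "k < t ! i" "z \<in> meets_cover U (take i t) (t ! i)"
    | l where "l < i" "k < t ! l" "z \<in> meets_cover U (take l t) (t ! l)"
    using assms by (auto simp: covered_beyond_def min_def split: if_splits)
  then show "z \<in> covered_beyond U k t m"
    using assms by cases (auto simp: covered_beyond_def)
qed

lemma covered_beyond_exists:
  assumes "\<And>s. \<exists>j. z \<in> U s j"
  shows "\<exists>m. z \<in> covered_beyond U k t m"
proof -
  obtain j where j: "\<And>s. z \<in> U s (j s)" using assms by metis
  define m where "m = Suc (k + (\<Sum>s | list_all2 (<) s t. j s))"
  have "j s < m" if "list_all2 (<) s t" for s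
  proof -
    have "j s \<le> (\<Sum>s | list_all2 (<) s t. j s)"
      using that by (intro member_le_sum finite_list_all2_less) auto
    then show ?thesis by (simp add: m_def)
  qed
  with j have "z \<in> covered_beyond U k t m"
    by (auto simp: covered_beyond_def meets_cover_def m_def)
  then show ?thesis ..
qed

text \<open>
  If some entry of \<open>t\<close> is at least \<open>j\<close>, look at the first one: the entries before it are below
  \<open>j\<close>, so keeping \<open>j\<close> sets in that inning covers \<open>z\<close>, and \<open>z\<close> stays covered afterwards.
\<close>

lemma covered_beyond_extend:
  assumes le: "j \<le> m"
    and short: "\<And>t. length t < n \<Longrightarrow> set t \<subseteq> {..<j} \<Longrightarrow> z \<in> covered_beyond U k t j"
    and top: "\<And>t. length t \<le> n \<Longrightarrow> set t \<subseteq> {..<j} \<Longrightarrow> z \<in> covered_beyond U k t m"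
    and t: "length t \<le> n" "set t \<subseteq> {..<m}"
  shows "z \<in> covered_beyond U k t m"
proof (cases "set t \<subseteq> {..<j}")
  case True
  with t top show ?thesis by blast
next
  case False
  define i where "i = length (takeWhile (\<lambda>a. a < j) t)"
  have pre: "take i t = takeWhile (\<lambda>a. a < j) t" by (simp add: i_def takeWhile_eq_take[symmetric])
  have i: "i < length t"
  proof -
    have "takeWhile (\<lambda>a. a < j) t \<noteq> t" using False by (auto simp: takeWhile_eq_all_conv)
    then show ?thesis unfolding i_def
      by (metis length_takeWhile_le le_neq_implies_less takeWhile_eq_take take_all order_refl)
  qed
  have "\<not> t ! i < j" using nth_length_takeWhile[of "\<lambda>a. a < j" t] i unfolding i_def by simp
  moreover have "set (take i t) \<subseteq> {..<j}" unfolding pre by (auto dest: set_takeWhileD)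
  then have "z \<in> covered_beyond U k (take i t) j" using short[of "take i t"] i t(1) by simp
  ultimately have "z \<in> covered_beyond U k (take i t) (t ! i)"
    using covered_beyond_mono[of j "t ! i" U k "take i t"] by auto
  then show ?thesis by (rule subsetD[OF covered_beyond_take[OF i]])
qed

text \<open>
  Pawlikowski's theorem for trees of countable covers. Hurewicz's diagonal argument yields numbers
  \<open>f n\<close> of sets to be kept such that every point is covered, in all positions below \<open>f\<close> at once,
  in infinitely many innings: the sets \<open>V n k m\<close> collect the points that are covered in all
  plays of length at most \<open>n\<close> with entries below \<open>m\<close>, they increase with \<open>m\<close> and cover. It remains to
  pass from finitely many sets to one. A function \<open>e\<close> from the positions of inning \<open>n\<close> to
  indices below \<open>f n\<close> gives the open set of points that \<open>e\<close> covers in every position; one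
  such function can be chosen for each \<open>n\<close>, and following these functions gives the branch.
\<close>

theorem selects_covers_tree_branch:
  fixes U :: "nat list \<Rightarrow> nat \<Rightarrow> 'z set"
  assumes Z: "selects_covers Z"
    and op: "\<And>s j. openin Z (U s j)"
    and cov: "\<And>s z. z \<in> topspace Z \<Longrightarrow> \<exists>j. z \<in> U s j"
  obtains g where "\<And>z. z \<in> topspace Z \<Longrightarrow> infinite {n. z \<in> U (map g [0..<n]) (g n)}"
proof -
  define T where "T n m = {t :: nat list. set t \<subseteq> {..<m} \<and> length t \<le> n}" for n m :: nat
  \<comment> \<open>the Hurewicz diagonal: one number \<open>m\<close> bounds both the earlier entries and the next one\<close>
  define V where "V n k m = {z \<in> topspace Z. \<forall>t\<in>T n m. z \<in> covered_beyond U k t m}" for n k m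
  have opV: "openin Z (V n k m)" for n k m
    unfolding V_def
    by (intro openin_Ball_finite openin_covered_beyond op)
       (simp add: T_def finite_lists_length_le)
  have monoV: "V n k m \<subseteq> V n k m'" if "m \<le> m'" for n k m m'
  proof
    fix z assume z: "z \<in> V n k m"
    have m: "z \<in> covered_beyond U k t m" if "length t \<le> n" "set t \<subseteq> {..<m}" for t
      using z that by (auto simp: V_def T_def)
    moreover have "z \<in> covered_beyond U k t m'" if "length t \<le> n" "set t \<subseteq> {..<m}" for t
      using m[OF that] covered_beyond_mono[OF \<open>m \<le> m'\<close>, of U k t] by blast
    ultimately have "z \<in> covered_beyond U k t m'" if "length t \<le> n" "set t \<subseteq> {..<m'}" for t
      using covered_beyond_extend[OF \<open>m \<le> m'\<close>, of n z U k t] that by simp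
    then show "z \<in> V n k m'" using z by (simp add: V_def T_def)
  qed
  have covV: "\<exists>m. z \<in> V n k m" if z: "z \<in> topspace Z" for z n k
  proof (induction n)
    case 0
    obtain m where "z \<in> covered_beyond U k [] m" using covered_beyond_exists cov z by metis
    then show ?case using z by (auto simp: V_def T_def)
  next
    case (Suc n)
    then obtain j where j: "z \<in> V n k j" by blast
    have "\<forall>t. \<exists>m. z \<in> covered_beyond U k t m" using covered_beyond_exists cov z by metis
    then obtain h where h: "\<And>t. z \<in> covered_beyond U k t (h t)" by metis
    define m where "m = j + (\<Sum>t\<in>T (Suc n) j. h t)"
    have "h t \<le> m" if "t \<in> T (Suc n) j" for t
    proof -
      have "finite (T (Suc n) j)" unfolding T_def by (simp add: finite_lists_length_le)
      then have "h t \<le> (\<Sum>t\<in>T (Suc n) j. h t)" using that by (intro member_le_sum) auto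
      then show ?thesis by (simp add: m_def)
    qed
    then have top: "z \<in> covered_beyond U k t m" if "t \<in> T (Suc n) j" for t
      using that h covered_beyond_mono[of "h t" m U k t] by blast
    have "z \<in> covered_beyond U k t m" if "length t \<le> Suc n" "set t \<subseteq> {..<m}" for t
      by (rule covered_beyond_extend[of j m "Suc n"])
         (use that top j in \<open>auto simp: m_def V_def T_def\<close>)
    then have "z \<in> V (Suc n) k m" using z by (auto simp: V_def T_def)
    then show ?case ..
  qed
  obtain f where f: "strict_mono f" "\<And>n. 0 < f n"
      "\<And>z k. z \<in> topspace Z \<Longrightarrow> \<exists>n. z \<in> V n k (f n)"
    by (rule selects_covers_Menger[OF Z, of V]) (use opV monoV covV in auto)
  \<comment> \<open>the play in which \<open>f n\<close> sets are kept in inning \<open>n\<close>\<close>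
  define F where "F n = map f [0..<n]" for n
  have inf: "infinite {n. z \<in> meets_cover U (F n) (f n)}" if z: "z \<in> topspace Z" for z
  proof
    assume fin: "finite {n. z \<in> meets_cover U (F n) (f n)}"
    \<comment> \<open>a threshold that no covering inning exceeds\<close>
    define k where "k = (\<Sum>n | z \<in> meets_cover U (F n) (f n). f n)"
    obtain n where n: "z \<in> V n k (f n)" using f(3)[OF z] by blast
    have "F n \<in> T n (f n)" using f(1) by (auto simp: T_def F_def strict_mono_less)
    then have "z \<in> covered_beyond U k (F n) (f n)" using n by (simp add: V_def)
    then have "(k < f n \<and> z \<in> meets_cover U (F n) (f n)) \<or>
       (\<exists>i<n. k < f i \<and> z \<in> meets_cover U (F i) (f i))"
      by (auto simp: covered_beyond_def F_def take_map)
    then obtain i where i: "k < f i" "z \<in> meets_cover U (F i) (f i)" by blast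
    then have "f i \<le> k" unfolding k_def using fin by (intro member_le_sum) auto
    with i show False by simp
  qed
  define M where "M n = {e. \<forall>s. list_all2 (<) s (F n) \<longrightarrow> e s < f n}" for n
  define W where "W n e = {z \<in> topspace Z. \<forall>s\<in>{s. list_all2 (<) s (F n)}. z \<in> U s (e s)}" for n e
  have opW: "openin Z (W n e)" for n e
  proof -
    have "{z \<in> topspace Z. z \<in> U s (e s)} = U s (e s)" for s using openin_subset[OF op] by blast
    then show ?thesis
      unfolding W_def using op by (intro openin_Ball_finite finite_list_all2_less) simp
  qed
  have neM: "M n \<noteq> {}" for n
  proof -
    have "(\<lambda>_. 0) \<in> M n" using f(2) by (simp add: M_def)
    then show ?thesis by blast
  qed
  have "{n. z \<in> meets_cover U (F n) (f n)} \<subseteq> {n. \<exists>e\<in>M n. z \<in> W n e}"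
    if z: "z \<in> topspace Z" for z
  proof safe
    fix n assume "z \<in> meets_cover U (F n) (f n)"
    then have "\<forall>s. \<exists>j. list_all2 (<) s (F n) \<longrightarrow> j < f n \<and> z \<in> U s j"
      by (auto simp: meets_cover_def)
    then obtain e where "\<forall>s. list_all2 (<) s (F n) \<longrightarrow> e s < f n \<and> z \<in> U s (e s)" by metis
    then show "\<exists>e\<in>M n. z \<in> W n e" using z by (auto simp: M_def W_def)
  qed
  with inf have "infinite {n. \<exists>e\<in>M n. z \<in> W n e}" if "z \<in> topspace Z" for z
    using that infinite_super by blast
  with neM opW obtain e where e: "\<And>n. e n \<in> M n"
      "\<And>z. z \<in> topspace Z \<Longrightarrow> infinite {n. z \<in> W n (e n)}"
    using selects_from_infinitely_often_covering[OF Z, of M W] by blast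
  define p where "p = rec_nat [] (\<lambda>n s. s @ [e n s])"
  have p: "p 0 = []" "\<And>n. p (Suc n) = p n @ [e n (p n)]" by (simp_all add: p_def)
  define g where "g n = e n (p n)" for n
  have pg: "p n = map g [0..<n]" for n by (induction n) (simp_all add: p g_def)
  have "list_all2 (<) (p n) (F n)" for n
  proof (induction n)
    case 0
    then show ?case by (simp add: p F_def)
  next
    case (Suc n)
    moreover from Suc have "e n (p n) < f n" using e(1)[of n] by (simp add: M_def)
    ultimately show ?case by (simp add: p F_def list_all2_appendI)
  qed
  then have "{n. z \<in> W n (e n)} \<subseteq> {n. z \<in> U (map g [0..<n]) (g n)}" for z
    by (auto simp: W_def pg[symmetric] g_def)
  then have "infinite {n. z \<in> U (map g [0..<n]) (g n)}" if "z \<in> topspace Z" for z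
    by (rule infinite_super) (rule e(2)[OF that])
  then show ?thesis by (rule that)
qed

text \<open>
  Countably many moves suffice in each position by the Lindelof property, and numbering them
  reduces the game to a tree of countable covers.
\<close>

theorem selects_covers_beats_game:
  fixes U :: "'m list \<Rightarrow> 'm \<Rightarrow> 'z set"
  assumes Z: "selects_covers Z"
    and op: "\<And>s m. m \<in> M s \<Longrightarrow> openin Z (U s m)"
    and cov: "\<And>s z. z \<in> topspace Z \<Longrightarrow> \<exists>m\<in>M s. z \<in> U s m"
  obtains g where "\<And>n. g n \<in> M (map g [0..<n])"
    "\<And>z. z \<in> topspace Z \<Longrightarrow> infinite {n. z \<in> U (map g [0..<n]) (g n)}"
proof -
  have "\<exists>e. (\<forall>n::nat. e n \<in> M s) \<and> (\<forall>z\<in>topspace Z. \<exists>n. z \<in> U s (e n))" for s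
    by (rule selects_covers_Lindelof[OF Z, of "M s" "U s"]) (use op cov in auto)
  then obtain e where e: "\<And>s n::nat. e s n \<in> M s"
      "\<And>s z. z \<in> topspace Z \<Longrightarrow> \<exists>n. z \<in> U s (e s n)"
    by metis
  \<comment> \<open>the position reached when the chosen moves have the given numbers\<close>
  define pos where "pos = foldl (\<lambda>p j. p @ [e p j]) []"
  have pos: "pos [] = []" "\<And>s j. pos (s @ [j]) = pos s @ [e (pos s) j]"
    by (simp_all add: pos_def)
  obtain h where h: "\<And>z. z \<in> topspace Z \<Longrightarrow>
      infinite {n. z \<in> U (pos (map h [0..<n])) (e (pos (map h [0..<n])) (h n))}"
    by (rule selects_covers_tree_branch[OF Z, of "\<lambda>s j. U (pos s) (e (pos s) j)"])
       (use op e in auto)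
  define g where "g n = e (pos (map h [0..<n])) (h n)" for n
  have "pos (map h [0..<n]) = map g [0..<n]" for n
    by (induction n) (simp_all add: pos g_def)
  then have "g n \<in> M (map g [0..<n])"
    "z \<in> topspace Z \<Longrightarrow> infinite {n. z \<in> U (map g [0..<n]) (g n)}" for n z
    using h[of z] e(1)[of "pos (map h [0..<n])" "h n"] by (auto simp: g_def)
  then show ?thesis by (rule that)
qed

section \<open>Selection principles and strategies in general\<close>

lemma Two_wins_G1_Markov_imp_Two_wins_G1:
  assumes "Two_wins_G1_Markov C D"
  shows "Two_wins_G1 C D"
proof -
  obtain \<tau> where \<tau>: "winning_Markov_strategy_Two C D \<tau>"
    using assms by (auto simp: Two_wins_G1_Markov_def)
  then have "winning_strategy_Two C D (\<lambda>s. \<tau> (last s) (length s - 1))"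
    by (auto simp: winning_strategy_Two_def winning_Markov_strategy_Two_def
        dest: subsetD[OF _ last_in_set])
  then show ?thesis by (auto simp: Two_wins_G1_def)
qed

lemma not_S1_imp_One_wins_G1:
  assumes "\<not> S1 C D"
  shows "One_wins_G1 C D"
proof -
  obtain A :: "nat \<Rightarrow> 'a set"
    where "\<forall>n. A n \<in> C" "\<forall>x. (\<forall>n. x n \<in> A n) \<longrightarrow> range x \<notin> D"
    using assms unfolding S1_def by blast
  then have "winning_strategy_One C D (\<lambda>s. A (length s))"
    by (auto simp: winning_strategy_One_def)
  then show ?thesis by (auto simp: One_wins_G1_def)
qed

lemma S1_select:
  fixes A :: "nat \<Rightarrow> 'b set"
  assumes "S1 C D" "\<And>n. A n \<in> C"
  obtains x where "\<forall>n. x n \<in> A n" "range x \<in> D"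
proof -
  have "\<exists>x. (\<forall>n. x n \<in> A n) \<and> range x \<in> D"
    using assms(1)[unfolded S1_def, rule_format, of A, OF assms(2)] by simp
  with that show ?thesis by blast
qed

lemma image_in_open_covers:
  assumes h: "\<And>U. U \<in> \<U> \<Longrightarrow> openin Y (h U) \<and> h U \<noteq> {} \<and> h U \<noteq> topspace Y"
    and cov: "topspace Y \<subseteq> \<Union>(h ` \<U>)"
  shows "h ` \<U> \<in> open_covers Y"
proof -
  have "\<Union>(h ` \<U>) \<subseteq> topspace Y" using h openin_subset by (intro UN_least) blast
  then have "\<Union>(h ` \<U>) = topspace Y" using cov by (rule subset_antisym)
  moreover have "V \<noteq> {}" "V \<noteq> topspace Y" "openin Y V" if "V \<in> h ` \<U>" for V
    using h that by auto
  ultimately show ?thesis unfolding open_covers_def by blast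
qed

lemma open_coversD:
  assumes "\<U> \<in> open_covers Y"
  shows "U \<in> \<U> \<Longrightarrow> openin Y U \<and> U \<noteq> {} \<and> U \<noteq> topspace Y" "\<Union>\<U> = topspace Y"
  using assms by (auto simp: open_covers_def)


section \<open>Covers that swallow the members of a family of compact sets\<close>

definition family_covers :: "'a topology \<Rightarrow> 'a set set \<Rightarrow> 'a set set set" where
  "family_covers X \<A> = {\<U> \<in> open_covers X. \<forall>A\<in>\<A>. \<exists>U\<in>\<U>. A \<subseteq> U}"

text \<open>
  The upper Vietoris topology on \<open>\<A>\<close>. The sets \<open>{B \<in> \<A>. B \<subseteq> U}\<close> with \<open>U\<close> open form a base.
\<close>

definition upper_topology :: "'a topology \<Rightarrow> 'a set set \<Rightarrow> 'a set topology" where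
  "upper_topology X \<A> = topology (\<lambda>\<O>. \<O> \<subseteq> \<A> \<and>
     (\<forall>A\<in>\<O>. \<exists>U. openin X U \<and> A \<subseteq> U \<and> {B \<in> \<A>. B \<subseteq> U} \<subseteq> \<O>))"

lemma openin_upper_topology:
  "openin (upper_topology X \<A>) \<O> \<longleftrightarrow> \<O> \<subseteq> \<A> \<and>
     (\<forall>A\<in>\<O>. \<exists>U. openin X U \<and> A \<subseteq> U \<and> {B \<in> \<A>. B \<subseteq> U} \<subseteq> \<O>)"
proof -
  let ?P = "\<lambda>\<O>. \<O> \<subseteq> \<A> \<and> (\<forall>A\<in>\<O>. \<exists>U. openin X U \<and> A \<subseteq> U \<and> {B \<in> \<A>. B \<subseteq> U} \<subseteq> \<O>)"
  have "istopology ?P"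
    unfolding istopology_def
  proof (intro conjI allI impI)
    fix S T assume S: "?P S" and T: "?P T"
    show "S \<inter> T \<subseteq> \<A>" using S by blast
    show "\<forall>A\<in>S \<inter> T. \<exists>U. openin X U \<and> A \<subseteq> U \<and> {B \<in> \<A>. B \<subseteq> U} \<subseteq> S \<inter> T"
    proof
      fix A assume "A \<in> S \<inter> T"
      then have "A \<in> S" "A \<in> T" by auto
      obtain U where "openin X U" "A \<subseteq> U" "{B \<in> \<A>. B \<subseteq> U} \<subseteq> S"
        using S \<open>A \<in> S\<close> by meson
      moreover obtain V where "openin X V" "A \<subseteq> V" "{B \<in> \<A>. B \<subseteq> V} \<subseteq> T"
        using T \<open>A \<in> T\<close> by meson
      ultimately have "openin X (U \<inter> V) \<and> A \<subseteq> U \<inter> V \<and> {B \<in> \<A>. B \<subseteq> U \<inter> V} \<subseteq> S \<inter> T" by auto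
      then show "\<exists>U. openin X U \<and> A \<subseteq> U \<and> {B \<in> \<A>. B \<subseteq> U} \<subseteq> S \<inter> T" by blast
    qed
  next
    fix \<K> assume *: "\<forall>K\<in>\<K>. ?P K"
    show "\<Union>\<K> \<subseteq> \<A>" using * by blast
    show "\<forall>A\<in>\<Union>\<K>. \<exists>U. openin X U \<and> A \<subseteq> U \<and> {B \<in> \<A>. B \<subseteq> U} \<subseteq> \<Union>\<K>"
      using * by (meson Union_iff Union_upper subset_trans)
  qed
  then show ?thesis by (simp add: upper_topology_def topology_inverse')
qed

locale proper_compact_family =
  fixes X :: "'a topology" and \<A> :: "'a set set"
  assumes regular: "regular_space X" and Hausdorff: "Hausdorff_space X"
    and nonempty: "topspace X \<noteq> {}"
    and compact_member: "A \<in> \<A> \<Longrightarrow> compactin X A"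
    and nonempty_member: "A \<in> \<A> \<Longrightarrow> A \<noteq> {}"
    and singleton_member: "x \<in> topspace X \<Longrightarrow> {x} \<in> \<A>"
    and Un_member: "A \<in> \<A> \<Longrightarrow> B \<in> \<A> \<Longrightarrow> A \<union> B \<in> \<A>"
    and topspace_not_member: "topspace X \<notin> \<A>"
begin

lemma member_subset: "A \<in> \<A> \<Longrightarrow> A \<subseteq> topspace X"
  by (simp add: compact_member compactin_subset_topspace)

lemma member_misses_point:
  assumes "A \<in> \<A>"
  obtains x where "x \<in> topspace X" "x \<notin> A"
proof -
  have "A \<noteq> topspace X" using assms topspace_not_member by auto
  with member_subset[OF assms] that show ?thesis by blast
qed

lemma openin_delete: "openin X U \<Longrightarrow> openin X (U - {x})"
  using Hausdorff Hausdorff_imp_t1_space t1_space_openin_delete_alt by blast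

lemma topspace_upper_topology [simp]: "topspace (upper_topology X \<A>) = \<A>"
proof (rule subset_antisym)
  show "topspace (upper_topology X \<A>) \<subseteq> \<A>"
    using openin_topspace[of "upper_topology X \<A>"] unfolding openin_upper_topology by blast
  have "openin (upper_topology X \<A>) \<A>"
    unfolding openin_upper_topology using member_subset by auto
  then show "\<A> \<subseteq> topspace (upper_topology X \<A>)" by (rule openin_subset)
qed

lemma openin_upper_topology_cone:
  "openin X U \<Longrightarrow> openin (upper_topology X \<A>) {A \<in> \<A>. A \<subseteq> U}"
  unfolding openin_upper_topology by blast

lemma range_in_family_covers:
  assumes "\<And>n. U n \<in> proper_opens X" "\<And>A. A \<in> \<A> \<Longrightarrow> \<exists>n. A \<subseteq> U n"
  shows "range U \<in> family_covers X \<A>"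
proof -
  have "\<exists>n. x \<in> U n" if "x \<in> topspace X" for x
    using assms(2)[OF singleton_member[OF that]] by simp
  moreover have "openin X (U n)" "U n \<noteq> {}" "U n \<noteq> topspace X" for n
    using assms(1)[of n] by (auto simp: proper_opens_def)
  ultimately show ?thesis
    using openin_subset assms(2) unfolding family_covers_def open_covers_def by fastforce
qed

lemma family_coversD:
  assumes "\<U> \<in> family_covers X \<A>"
  shows "U \<in> \<U> \<Longrightarrow> U \<in> proper_opens X" "A \<in> \<A> \<Longrightarrow> \<exists>U\<in>\<U>. A \<subseteq> U"
  using assms by (auto simp: family_covers_def open_covers_def proper_opens_def)

text \<open>
  A point outside of \<open>A\<close> can be removed from \<open>U\<close>.
\<close>

lemma member_in_proper_open:
  assumes "A \<in> \<A>" "openin X U" "A \<subseteq> U"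
  obtains V where "V \<in> proper_opens X" "A \<subseteq> V" "V \<subseteq> U"
proof -
  obtain x where x: "x \<in> topspace X" "x \<notin> A" using assms(1) by (rule member_misses_point)
  have "openin X (U - {x})" using assms(2) by (rule openin_delete)
  moreover have "A \<subseteq> U - {x}" using assms x by blast
  moreover from this have "U - {x} \<noteq> {}" using assms(1) nonempty_member by blast
  ultimately have "U - {x} \<in> proper_opens X" using x by (auto simp: proper_opens_def)
  with \<open>A \<subseteq> U - {x}\<close> show ?thesis by (intro that[of "U - {x}"]) auto
qed

text \<open>
  The open sets \<open>U\<close> whose cone \<open>{A \<in> \<A>. A \<subseteq> U}\<close> lies in a member of the given cover form an
  \<open>\<A>\<close>-cover; they can be taken proper because no member of \<open>\<A>\<close> is the whole space.
\<close>

lemma S1_family_covers_imp_selects_covers: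
  assumes S1: "S1 (family_covers X \<A>) (family_covers X \<A>)"
  shows "selects_covers (upper_topology X \<A>)"
  unfolding selects_covers_def
proof (intro allI impI)
  fix \<G> :: "nat \<Rightarrow> 'a set set set"
  assume \<G>: "\<forall>n. (\<forall>G\<in>\<G> n. openin (upper_topology X \<A>) G) \<and>
      topspace (upper_topology X \<A>) \<subseteq> \<Union>(\<G> n)"
  define \<U> where "\<U> n = {U \<in> proper_opens X. \<exists>G\<in>\<G> n. {A \<in> \<A>. A \<subseteq> U} \<subseteq> G}" for n
  have cov: "\<exists>U\<in>\<U> n. A \<subseteq> U" if A: "A \<in> \<A>" for n A
  proof -
    have "\<A> \<subseteq> \<Union>(\<G> n)" using \<G> by simp
    then obtain G where G: "G \<in> \<G> n" "A \<in> G" using A by blast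
    then have "openin (upper_topology X \<A>) G" using \<G> by blast
    then obtain U where U: "openin X U" "A \<subseteq> U" "{B \<in> \<A>. B \<subseteq> U} \<subseteq> G"
      using G(2) unfolding openin_upper_topology by blast
    obtain V where V: "V \<in> proper_opens X" "A \<subseteq> V" "V \<subseteq> U"
      using A U(1,2) by (rule member_in_proper_open)
    have "{B \<in> \<A>. B \<subseteq> V} \<subseteq> G" using U(3) V(3) by blast
    then have "V \<in> \<U> n" using V(1) G(1) unfolding \<U>_def by blast
    with V(2) show ?thesis by blast
  qed
  have "\<U> n \<in> family_covers X \<A>" for n
  proof -
    have "\<Union>(\<U> n) = topspace X"
    proof
      show "\<Union>(\<U> n) \<subseteq> topspace X"
        using openin_subset by (fastforce simp: \<U>_def proper_opens_def)
      show "topspace X \<subseteq> \<Union>(\<U> n)"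
        using cov singleton_member by fastforce
    qed
    then show ?thesis
      using cov by (auto simp: family_covers_def open_covers_def \<U>_def proper_opens_def)
  qed
  then obtain U where U: "\<And>n. U n \<in> \<U> n" "range U \<in> family_covers X \<A>"
    using S1 unfolding S1_def by blast
  have "\<forall>n. \<exists>G. G \<in> \<G> n \<and> {A \<in> \<A>. A \<subseteq> U n} \<subseteq> G" using U(1) by (auto simp: \<U>_def)
  then obtain u where "\<forall>n. u n \<in> \<G> n \<and> {A \<in> \<A>. A \<subseteq> U n} \<subseteq> u n"
    using choice by meson
  then have u: "\<And>n. u n \<in> \<G> n" "\<And>n. {A \<in> \<A>. A \<subseteq> U n} \<subseteq> u n" by blast+
  have "\<A> \<subseteq> \<Union>(range u)"
  proof
    fix A assume A: "A \<in> \<A>"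
    then obtain n where "A \<subseteq> U n" using family_coversD(2)[OF U(2)] by blast
    then show "A \<in> \<Union>(range u)" using u(2)[of n] A by blast
  qed
  then show "\<exists>u. (\<forall>n. u n \<in> \<G> n) \<and> topspace (upper_topology X \<A>) \<subseteq> \<Union>(range u)"
    using u(1) by auto
qed

lemma S1_family_covers_beats_game:
  fixes U :: "'m list \<Rightarrow> 'm \<Rightarrow> 'a set"
  assumes S1: "S1 (family_covers X \<A>) (family_covers X \<A>)"
    and op: "\<And>s m. m \<in> M s \<Longrightarrow> openin X (U s m)"
    and cov: "\<And>s A. A \<in> \<A> \<Longrightarrow> \<exists>m\<in>M s. A \<subseteq> U s m"
  obtains g where "\<And>n. g n \<in> M (map g [0..<n])"
    "\<And>A. A \<in> \<A> \<Longrightarrow> infinite {n. A \<subseteq> U (map g [0..<n]) (g n)}"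
proof -
  obtain g where g: "\<And>n. g n \<in> M (map g [0..<n])"
    "\<And>A. A \<in> topspace (upper_topology X \<A>) \<Longrightarrow>
       infinite {n. A \<in> {A \<in> \<A>. A \<subseteq> U (map g [0..<n]) (g n)}}"
    by (rule selects_covers_beats_game[OF S1_family_covers_imp_selects_covers[OF S1],
          of M "\<lambda>s m. {A \<in> \<A>. A \<subseteq> U s m}"])
       (use op cov openin_upper_topology_cone in auto)
  show ?thesis
  proof (rule that[of g])
    show "infinite {n. A \<subseteq> U (map g [0..<n]) (g n)}" if "A \<in> \<A>" for A
      using g(2)[of A] that by simp
  qed (rule g(1))
qed

text \<open>
  Positions that cannot arise in the game are given One's first move, so that every position
  carries a cover.
\<close>

lemma S1_imp_not_One_wins_cover_game:
  assumes S1: "S1 (family_covers X \<A>) (family_covers X \<A>)"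
  shows "\<not> One_wins_G1 (family_covers X \<A>) (family_covers X \<A>)"
proof
  let ?C = "family_covers X \<A>"
  assume "One_wins_G1 ?C ?C"
  then obtain \<sigma> where \<sigma>: "\<And>s. set s \<subseteq> \<Union>?C \<Longrightarrow> \<sigma> s \<in> ?C"
      "\<And>x. (\<And>n. x n \<in> \<sigma> (map x [0..<n])) \<Longrightarrow> range x \<notin> ?C"
    by (auto simp: One_wins_G1_def winning_strategy_One_def)
  define M where "M s = (if set s \<subseteq> \<Union>?C then \<sigma> s else \<sigma> [])" for s
  have M: "M s \<in> ?C" for s using \<sigma>(1) by (simp add: M_def)
  obtain x where x: "\<And>n. x n \<in> M (map x [0..<n])"
      "\<And>A. A \<in> \<A> \<Longrightarrow> infinite {n. A \<subseteq> x n}"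
    by (rule S1_family_covers_beats_game[OF S1, of M "\<lambda>_ V. V"])
       (use family_coversD[OF M] in \<open>auto simp: proper_opens_def\<close>)
  have "set (map x [0..<n]) \<subseteq> \<Union>?C" for n using x(1) M by fastforce
  then have "x n \<in> \<sigma> (map x [0..<n])" for n using x(1)[of n] by (simp add: M_def)
  then have "range x \<notin> ?C" by (rule \<sigma>(2))
  moreover have "range x \<in> ?C"
  proof (rule range_in_family_covers)
    show "x n \<in> proper_opens X" for n by (rule family_coversD(1)[OF M x(1)])
    show "\<exists>n. A \<subseteq> x n" if "A \<in> \<A>" for A using x(2)[OF that] not_finite_existsD by blast
  qed
  ultimately show False by blast
qed

lemma S1_imp_not_Two_wins_nhds_set_game:
  assumes S1: "S1 (family_covers X \<A>) (family_covers X \<A>)"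
  shows "\<not> Two_wins_G1 (nhds_set X ` \<A>) (- family_covers X \<A>)"
proof
  assume "Two_wins_G1 (nhds_set X ` \<A>) (- family_covers X \<A>)"
  then obtain \<tau> where \<tau>: "\<And>s. s \<noteq> [] \<Longrightarrow> set s \<subseteq> nhds_set X ` \<A> \<Longrightarrow> \<tau> s \<in> last s"
      "\<And>N. (\<And>n::nat. N n \<in> nhds_set X ` \<A>) \<Longrightarrow>
         range (\<lambda>n. \<tau> (map N [0..<Suc n])) \<notin> family_covers X \<A>"
    by (auto simp: Two_wins_G1_def winning_strategy_Two_def)
  define U where "U s A = (if set s \<subseteq> \<A> then \<tau> (map (nhds_set X) (s @ [A])) else topspace X)"
    for s A
  have U: "U s A \<in> nhds_set X A" if "set s \<subseteq> \<A>" "A \<in> \<A>" for s A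
    using \<tau>(1)[of "map (nhds_set X) (s @ [A])"] that by (auto simp: U_def)
  obtain g where g: "\<And>n. g n \<in> \<A>"
      "\<And>A. A \<in> \<A> \<Longrightarrow> infinite {n. A \<subseteq> U (map g [0..<n]) (g n)}"
  proof (rule S1_family_covers_beats_game[OF S1, of "\<lambda>_. \<A>" U])
    show "openin X (U s A)" if "A \<in> \<A>" for s A
      using U[of s A] that by (cases "set s \<subseteq> \<A>") (auto simp: nhds_set_def proper_opens_def U_def)
    show "\<exists>B\<in>\<A>. A \<subseteq> U s B" if "A \<in> \<A>" for s A
      using U[of s A] that member_subset
      by (cases "set s \<subseteq> \<A>") (auto simp: nhds_set_def U_def)
  qed auto
  have sub: "set (map g [0..<n]) \<subseteq> \<A>" for n using g(1) by auto
  have Ug: "U (map g [0..<n]) (g n) = \<tau> (map (\<lambda>n. nhds_set X (g n)) [0..<Suc n])" for n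
    using sub[of n] by (simp add: U_def comp_def)
  have "range (\<lambda>n. U (map g [0..<n]) (g n)) \<in> family_covers X \<A>"
  proof (rule range_in_family_covers)
    show "U (map g [0..<n]) (g n) \<in> proper_opens X" for n
      using U[OF sub g(1)] by (auto simp: nhds_set_def)
    show "\<exists>n. A \<subseteq> U (map g [0..<n]) (g n)" if "A \<in> \<A>" for A
      using g(2)[OF that] not_finite_existsD by blast
  qed
  moreover have "range (\<lambda>n. U (map g [0..<n]) (g n)) \<notin> family_covers X \<A>"
    unfolding Ug using g(1) by (intro \<tau>(2)) auto
  ultimately show False by blast
qed

text \<open>
  A selection from \<open>\<A>\<close>-covers can fail to be an \<open>\<A>\<close>-cover only by missing a member of \<open>\<A>\<close>.
\<close>

lemma not_S1_bad_covers:
  assumes "\<not> S1 (family_covers X \<A>) (family_covers X \<A>)"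
  obtains \<U> where "\<And>n::nat. \<U> n \<in> family_covers X \<A>"
    "\<And>U. (\<And>n. U n \<in> \<U> n) \<Longrightarrow> \<exists>A\<in>\<A>. \<forall>n. \<not> A \<subseteq> U n"
proof -
  obtain \<U> :: "nat \<Rightarrow> 'a set set" where \<U>: "\<forall>n. \<U> n \<in> family_covers X \<A>"
      "\<forall>U. (\<forall>n. U n \<in> \<U> n) \<longrightarrow> range U \<notin> family_covers X \<A>"
    using assms unfolding S1_def by blast
  have "\<exists>A\<in>\<A>. \<forall>n. \<not> A \<subseteq> U n" if U: "\<And>n. U n \<in> \<U> n" for U
    using \<U>(2)[rule_format, of U, OF U] range_in_family_covers[of U] family_coversD(1)[OF \<U>(1)[rule_format] U] by blast
  with \<U>(1) that show ?thesis by blast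
qed

text \<open>
  Two answers the neighbourhoods of \<open>A\<close> in inning \<open>n\<close> by a member of the \<open>n\<close>-th bad cover that
  contains \<open>A\<close>.
\<close>

lemma not_S1_imp_Two_wins_Markov_nhds_set_game:
  assumes "\<not> S1 (family_covers X \<A>) (family_covers X \<A>)"
  shows "Two_wins_G1_Markov (nhds_set X ` \<A>) (- family_covers X \<A>)"
proof -
  obtain \<U> where \<U>: "\<And>n::nat. \<U> n \<in> family_covers X \<A>"
    "\<And>U. (\<And>n. U n \<in> \<U> n) \<Longrightarrow> \<exists>A\<in>\<A>. \<forall>n. \<not> A \<subseteq> U n"
    using assms by (rule not_S1_bad_covers) blast
  define \<tau> where "\<tau> N n = (SOME U. U \<in> \<U> n \<and> U \<in> N)" for N n
  have \<tau>: "\<tau> N n \<in> \<U> n \<and> \<tau> N n \<in> N" if N: "N \<in> nhds_set X ` \<A>" for N n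
  proof -
    obtain A where A: "A \<in> \<A>" "N = nhds_set X A" using N by blast
    then obtain U where "U \<in> \<U> n" "A \<subseteq> U" using family_coversD(2)[OF \<U>(1)] by blast
    then have "U \<in> \<U> n \<and> U \<in> N"
      using family_coversD(1)[OF \<U>(1)] A by (auto simp: nhds_set_def)
    then show ?thesis unfolding \<tau>_def by (rule someI)
  qed
  have "range (\<lambda>n. \<tau> (N n) n) \<notin> family_covers X \<A>" if N: "\<And>n. N n \<in> nhds_set X ` \<A>" for N
  proof
    assume "range (\<lambda>n. \<tau> (N n) n) \<in> family_covers X \<A>"
    then have "\<exists>n. A \<subseteq> \<tau> (N n) n" if "A \<in> \<A>" for A
      using family_coversD(2)[OF _ that] by fastforce
    moreover have "\<exists>A\<in>\<A>. \<forall>n. \<not> A \<subseteq> \<tau> (N n) n"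
      by (rule \<U>(2)) (rule conjunct1[OF \<tau>[OF N]])
    ultimately show False by blast
  qed
  with \<tau> have "winning_Markov_strategy_Two (nhds_set X ` \<A>) (- family_covers X \<A>) \<tau>"
    by (simp add: winning_Markov_strategy_Two_def)
  then show ?thesis by (auto simp: Two_wins_G1_Markov_def)
qed

end

section \<open>Constructing minimal cusco maps\<close>

lemma compactin_subset_increasing_open:
  fixes G :: "nat \<Rightarrow> 'a set"
  assumes K: "compactin X K" and G: "\<And>n. openin X (G n)" "\<And>m n. m \<le> n \<Longrightarrow> G m \<subseteq> G n"
    and sub: "K \<subseteq> (\<Union>n. G n)"
  obtains n where "K \<subseteq> G n"
proof -
  have "\<exists>\<F>. finite \<F> \<and> \<F> \<subseteq> range G \<and> K \<subseteq> \<Union>\<F>"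
    using K by (rule compactinD) (use G sub in auto)
  then obtain \<F> where \<F>: "finite \<F>" "\<F> \<subseteq> range G" "K \<subseteq> \<Union>\<F>" by blast
  obtain N where N: "finite N" "\<F> = G ` N" using finite_subset_image[OF \<F>(1,2)] by blast
  have "K \<subseteq> G (Max (insert 0 N))"
  proof
    fix x assume "x \<in> K"
    then obtain n where n: "n \<in> N" "x \<in> G n" using \<F>(3) N(2) by blast
    then have "n \<le> Max (insert 0 N)" using N(1) by simp
    from G(2)[OF this] n(2) show "x \<in> G (Max (insert 0 N))" by blast
  qed
  then show ?thesis by (rule that)
qed

lemma cusco_mapD:
  assumes "cusco_map X \<Phi>"
  shows "x \<in> topspace X \<Longrightarrow> \<Phi> x \<noteq> {}" "x \<in> topspace X \<Longrightarrow> compact (\<Phi> x)"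
    "x \<in> topspace X \<Longrightarrow> convex (\<Phi> x)" "\<Phi> \<in> extensional (topspace X)"
    "open V \<Longrightarrow> openin X {x \<in> topspace X. \<Phi> x \<subseteq> V}"
  using assms by (auto simp: cusco_map_def)

lemma cusco_map_ext:
  assumes "cusco_map X \<Phi>" "cusco_map X \<Psi>" "\<And>x. x \<in> topspace X \<Longrightarrow> \<Phi> x = \<Psi> x"
  shows "\<Phi> = \<Psi>"
  using assms(3) by (rule extensionalityI[OF cusco_mapD(4)[OF assms(1)] cusco_mapD(4)[OF assms(2)]])

lemma graph_on_subset_iff:
  "graph_on X \<Psi> \<subseteq> graph_on X \<Phi> \<longleftrightarrow> (\<forall>x\<in>topspace X. \<Psi> x \<subseteq> \<Phi> x)"
  by (auto simp: graph_on_def)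

lemma MC_iff:
  "\<Phi> \<in> MC X \<longleftrightarrow> cusco_map X \<Phi> \<and>
     (\<forall>\<Psi>. cusco_map X \<Psi> \<and> (\<forall>x\<in>topspace X. \<Psi> x \<subseteq> \<Phi> x) \<longrightarrow> \<Psi> = \<Phi>)"
proof -
  have "graph_on X \<Psi> = graph_on X \<Phi> \<longleftrightarrow> \<Psi> = \<Phi>" if "cusco_map X \<Psi>" "cusco_map X \<Phi>"
    for \<Psi> \<Phi> :: "'a \<Rightarrow> real set"
  proof
    assume "graph_on X \<Psi> = graph_on X \<Phi>"
    then show "\<Psi> = \<Phi>"
      using graph_on_subset_iff[of X \<Psi> \<Phi>] graph_on_subset_iff[of X \<Phi> \<Psi>]
      by (intro cusco_map_ext[OF that] subset_antisym) auto
  qed simp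
  then show ?thesis by (auto simp: MC_def graph_on_subset_iff)
qed

lemma MC_imp_cusco_map: "\<Phi> \<in> MC X \<Longrightarrow> cusco_map X \<Phi>"
  by (simp add: MC_def)

lemma MC_minimal:
  "\<Phi> \<in> MC X \<Longrightarrow> cusco_map X \<Psi> \<Longrightarrow> (\<And>x. x \<in> topspace X \<Longrightarrow> \<Psi> x \<subseteq> \<Phi> x) \<Longrightarrow> \<Psi> = \<Phi>"
  by (simp add: MC_iff)

text \<open>
  Compactness is used twice: for the value at each point, and then for \<open>K\<close>.
\<close>

lemma cusco_map_compact_uniform:
  fixes B :: "nat \<Rightarrow> real set"
  assumes \<Phi>: "cusco_map X \<Phi>" and K: "compactin X K"
    and B: "\<And>n. open (B n)" "\<And>m n. m \<le> n \<Longrightarrow> B m \<subseteq> B n"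
    and sub: "\<And>x. x \<in> K \<Longrightarrow> \<Phi> x \<subseteq> (\<Union>n. B n)"
  obtains n where "\<And>x. x \<in> K \<Longrightarrow> \<Phi> x \<subseteq> B n"
proof -
  have KX: "K \<subseteq> topspace X" using K by (rule compactin_subset_topspace)
  have "\<exists>n. \<Phi> x \<subseteq> B n" if x: "x \<in> K" for x
  proof -
    have "compactin euclidean (\<Phi> x)" using cusco_mapD(2)[OF \<Phi>] x KX by auto
    then show ?thesis
      by (rule compactin_subset_increasing_open[of _ _ B]) (use B sub[OF x] in auto)
  qed
  then have cov: "K \<subseteq> (\<Union>n. {x \<in> topspace X. \<Phi> x \<subseteq> B n})" using KX by auto
  have mono: "{x \<in> topspace X. \<Phi> x \<subseteq> B m} \<subseteq> {x \<in> topspace X. \<Phi> x \<subseteq> B n}" if "m \<le> n" for m n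
    using B(2)[OF that] by auto
  obtain n where "K \<subseteq> {x \<in> topspace X. \<Phi> x \<subseteq> B n}"
    by (rule compactin_subset_increasing_open[OF K cusco_mapD(5)[OF \<Phi> B(1)] mono cov])
  then show ?thesis by (intro that[of n]) auto
qed

lemma cusco_map_singletons:
  "cusco_map X \<Phi> \<Longrightarrow> (\<And>x. x \<in> topspace X \<Longrightarrow> is_singleton (\<Phi> x)) \<Longrightarrow> \<Phi> \<in> MC X"
  unfolding MC_iff
proof (intro conjI allI impI)
  fix \<Psi> assume \<Phi>: "cusco_map X \<Phi>" and single: "\<And>x. x \<in> topspace X \<Longrightarrow> is_singleton (\<Phi> x)"
    and \<Psi>: "cusco_map X \<Psi> \<and> (\<forall>x\<in>topspace X. \<Psi> x \<subseteq> \<Phi> x)"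
  have "\<Psi> x = \<Phi> x" if x: "x \<in> topspace X" for x
    using single[OF x] \<Psi> cusco_mapD(1)[of X \<Psi>] x
    by (metis is_singletonE subset_singletonD)
  with \<Phi> \<Psi> show "\<Psi> = \<Phi>" by (intro cusco_map_ext) auto
qed simp

definition const_MC :: "'a topology \<Rightarrow> real \<Rightarrow> 'a \<Rightarrow> real set" where
  "const_MC X c = restrict (\<lambda>_. {c}) (topspace X)"

lemma const_MC_in_MC: "const_MC X c \<in> MC X"
proof (rule cusco_map_singletons)
  have "openin X {x \<in> topspace X. {c} \<subseteq> V}" for V by (cases "c \<in> V") auto
  then have "openin X {x \<in> topspace X. const_MC X c x \<subseteq> V}" for V
    by (simp add: const_MC_def cong: conj_cong)
  then show "cusco_map X (const_MC X c)"
    by (auto simp: cusco_map_def const_MC_def)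
qed (simp add: const_MC_def)

lemma zero_MC_in_MC: "zero_MC X \<in> MC X"
  using const_MC_in_MC[of X 0] by (simp add: const_MC_def zero_MC_def)

text \<open>
  If the intersection of the values at \<open>x\<close> lies in an open set \<open>V\<close>, then so does one of the values,
  because the differences with \<open>V\<close> form a chain of compact sets. This gives both that the
  intersection is non-empty and that it depends upper semicontinuously on \<open>x\<close>.
\<close>

lemma cusco_map_Inter_chain:
  assumes ne: "P \<noteq> {}" and P: "\<And>\<Psi>. \<Psi> \<in> P \<Longrightarrow> cusco_map X \<Psi>"
    and chain: "\<And>\<Phi> \<Psi>. \<Phi> \<in> P \<Longrightarrow> \<Psi> \<in> P \<Longrightarrow>
      (\<forall>x\<in>topspace X. \<Phi> x \<subseteq> \<Psi> x) \<or> (\<forall>x\<in>topspace X. \<Psi> x \<subseteq> \<Phi> x)"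
  shows "cusco_map X (restrict (\<lambda>x. \<Inter>\<Psi>\<in>P. \<Psi> x) (topspace X))"
proof -
  let ?\<Xi> = "restrict (\<lambda>x. \<Inter>\<Psi>\<in>P. \<Psi> x) (topspace X)"
  have escape: "\<exists>\<Psi>\<in>P. \<Psi> x \<subseteq> V" if x: "x \<in> topspace X" and V: "open V" "(\<Inter>\<Psi>\<in>P. \<Psi> x) \<subseteq> V" for x V
  proof (rule ccontr)
    assume "\<not> ?thesis"
    then have "{} \<notin> (\<lambda>\<Psi>. \<Psi> x - V) ` P" by auto
    moreover have "compact S" if "S \<in> (\<lambda>\<Psi>. \<Psi> x - V) ` P" for S
      using that cusco_mapD(2)[OF P x] V(1) by (auto intro!: compact_diff)
    moreover have "S \<subseteq> T \<or> T \<subseteq> S"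
      if "S \<in> (\<lambda>\<Psi>. \<Psi> x - V) ` P \<and> T \<in> (\<lambda>\<Psi>. \<Psi> x - V) ` P" for S T
      using that chain x by blast
    ultimately have "\<Inter>((\<lambda>\<Psi>. \<Psi> x - V) ` P) \<noteq> {}" by (intro compact_chain) auto
    then show False using V(2) ne by auto
  qed
  have "(\<Inter>\<Psi>\<in>P. \<Psi> x) \<noteq> {}" if x: "x \<in> topspace X" for x
    using escape[OF x, of "{}"] cusco_mapD(1)[OF P x] by auto
  moreover have "compact (\<Inter>\<Psi>\<in>P. \<Psi> x)" if x: "x \<in> topspace X" for x
  proof -
    obtain \<Psi> where \<Psi>: "\<Psi> \<in> P" using ne by blast
    have "(\<Inter>\<Psi>\<in>P. \<Psi> x) = \<Psi> x \<inter> (\<Inter>\<Psi>\<in>P. \<Psi> x)" using \<Psi> by blast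
    moreover have "compact \<dots>"
      using \<Psi> cusco_mapD(2)[OF P x]
      by (intro compact_Int_closed closed_INT) (auto intro: compact_imp_closed)
    ultimately show ?thesis by simp
  qed
  moreover have "convex (\<Inter>\<Psi>\<in>P. \<Psi> x)" if x: "x \<in> topspace X" for x
    using cusco_mapD(3)[OF P x] by (intro convex_INT) auto
  moreover have "openin X {x \<in> topspace X. ?\<Xi> x \<subseteq> V}" if V: "open V" for V
  proof -
    have "{x \<in> topspace X. ?\<Xi> x \<subseteq> V} = (\<Union>\<Psi>\<in>P. {x \<in> topspace X. \<Psi> x \<subseteq> V})"
      using escape V by auto
    moreover have "openin X \<dots>" using cusco_mapD(5)[OF P V] by (intro openin_Union) auto
    ultimately show ?thesis by simp
  qed
  ultimately show ?thesis by (auto simp: cusco_map_def)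
qed

text \<open>
  Zorn's lemma, applied to the complements of the graphs within the graph of \<open>\<Theta>\<close>: minimal maps
  correspond to maximal complements.
\<close>

lemma ex_minimal_cusco_below:
  assumes \<Theta>: "cusco_map X \<Theta>"
  obtains \<Psi> where "\<Psi> \<in> MC X" "\<And>x. x \<in> topspace X \<Longrightarrow> \<Psi> x \<subseteq> \<Theta> x"
proof -
  define Q where "Q = {\<Psi>. cusco_map X \<Psi> \<and> graph_on X \<Psi> \<subseteq> graph_on X \<Theta>}"
  define \<S> where "\<S> = (\<lambda>\<Psi>. graph_on X \<Theta> - graph_on X \<Psi>) ` Q"
  have "\<exists>M\<in>\<S>. \<forall>S\<in>\<S>. M \<subseteq> S \<longrightarrow> S = M"
  proof (rule subset_Zorn_nonempty)
    show "\<S> \<noteq> {}" using \<Theta> by (auto simp: \<S>_def Q_def)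
    fix \<C> assume \<C>: "\<C> \<noteq> {}" "subset.chain \<S> \<C>"
    define P where "P = {\<Psi> \<in> Q. graph_on X \<Theta> - graph_on X \<Psi> \<in> \<C>}"
    define \<Xi> where "\<Xi> = restrict (\<lambda>x. \<Inter>\<Psi>\<in>P. \<Psi> x) (topspace X)"
    have \<C>P: "\<C> = (\<lambda>\<Psi>. graph_on X \<Theta> - graph_on X \<Psi>) ` P"
      using \<C>(2) by (auto simp: subset_chain_def \<S>_def P_def)
    then have ne: "P \<noteq> {}" using \<C>(1) by auto
    have "cusco_map X \<Xi>"
      unfolding \<Xi>_def
    proof (rule cusco_map_Inter_chain[OF ne])
      fix \<Phi> \<Psi> assume PP: "\<Phi> \<in> P" "\<Psi> \<in> P"
      then have "graph_on X \<Theta> - graph_on X \<Phi> \<subseteq> graph_on X \<Theta> - graph_on X \<Psi> \<or>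
          graph_on X \<Theta> - graph_on X \<Psi> \<subseteq> graph_on X \<Theta> - graph_on X \<Phi>"
        using \<C>(2) by (auto simp: subset_chain_def P_def)
      then have "graph_on X \<Psi> \<subseteq> graph_on X \<Phi> \<or> graph_on X \<Phi> \<subseteq> graph_on X \<Psi>"
        using PP by (auto simp: P_def Q_def)
      then show "(\<forall>x\<in>topspace X. \<Phi> x \<subseteq> \<Psi> x) \<or> (\<forall>x\<in>topspace X. \<Psi> x \<subseteq> \<Phi> x)"
        by (auto simp: graph_on_def)
    qed (auto simp: P_def Q_def)
    moreover have graph: "graph_on X \<Xi> = (\<Inter>\<Psi>\<in>P. graph_on X \<Psi>)"
      using ne by (auto simp: graph_on_def \<Xi>_def)
    then have "graph_on X \<Xi> \<subseteq> graph_on X \<Theta>" using ne by (auto simp: P_def Q_def)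
    ultimately have "\<Xi> \<in> Q" by (simp add: Q_def)
    moreover have "\<Union>\<C> = graph_on X \<Theta> - graph_on X \<Xi>" unfolding \<C>P graph by blast
    ultimately show "\<Union>\<C> \<in> \<S>" by (auto simp: \<S>_def)
  qed
  then obtain \<Psi> where \<Psi>: "\<Psi> \<in> Q"
      "\<And>\<Psi>'. \<Psi>' \<in> Q \<Longrightarrow> graph_on X \<Theta> - graph_on X \<Psi> \<subseteq> graph_on X \<Theta> - graph_on X \<Psi>' \<Longrightarrow>
        graph_on X \<Theta> - graph_on X \<Psi>' = graph_on X \<Theta> - graph_on X \<Psi>"
    unfolding \<S>_def by blast
  have "\<Psi> \<in> MC X"
    unfolding MC_def
  proof (intro CollectI conjI allI impI)
    show "cusco_map X \<Psi>" using \<Psi>(1) by (simp add: Q_def)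
    fix \<Psi>' assume "cusco_map X \<Psi>' \<and> graph_on X \<Psi>' \<subseteq> graph_on X \<Psi>"
    moreover from this have "\<Psi>' \<in> Q" using \<Psi>(1) by (auto simp: Q_def)
    ultimately show "graph_on X \<Psi>' = graph_on X \<Psi>"
      using \<Psi>(2)[of \<Psi>'] \<Psi>(1) by (auto simp: Q_def)
  qed
  moreover have "\<Psi> x \<subseteq> \<Theta> x" if "x \<in> topspace X" for x
    using \<Psi>(1) that by (auto simp: Q_def graph_on_def)
  ultimately show ?thesis by (rule that)
qed

text \<open>
  The map jumps from \<open>\<Phi>\<close> to \<open>c\<close> across the boundary of \<open>V\<close>. Taking the convex hull of both values
  there keeps it upper semicontinuous.
\<close>

lemma cusco_map_hull_on_closed_nbhd:
  fixes c :: real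
  assumes \<Phi>: "cusco_map X \<Phi>" and V: "openin X V"
  defines "\<Theta> \<equiv> restrict (\<lambda>x. if x \<in> V then \<Phi> x else if x \<in> X closure_of V
      then convex hull (insert c (\<Phi> x)) else {c}) (topspace X)"
  shows "cusco_map X \<Theta>"
  unfolding cusco_map_def
proof (intro conjI ballI allI impI)
  show "\<Theta> \<in> extensional (topspace X)" by (simp add: \<Theta>_def)
  fix x assume x: "x \<in> topspace X"
  note \<Phi>x = cusco_mapD(1,2,3)[OF \<Phi> x]
  show "\<Theta> x \<noteq> {}" using x \<Phi>x(1) by (simp add: \<Theta>_def)
  show "compact (\<Theta> x)" using x \<Phi>x(2) by (simp add: \<Theta>_def compact_convex_hull)
  show "convex (\<Theta> x)" using x \<Phi>x(3) by (simp add: \<Theta>_def)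
next
  fix N :: "real set" assume N: "open N"
  show "openin X {x \<in> topspace X. \<Theta> x \<subseteq> N}"
  proof (subst openin_subopen, intro ballI)
    fix x assume "x \<in> {x \<in> topspace X. \<Theta> x \<subseteq> N}"
    then have x: "x \<in> topspace X" and xN: "\<Theta> x \<subseteq> N" by auto
    consider "x \<in> V" | "x \<notin> X closure_of V" | "x \<notin> V" "x \<in> X closure_of V" by blast
    then show "\<exists>T. openin X T \<and> x \<in> T \<and> T \<subseteq> {x \<in> topspace X. \<Theta> x \<subseteq> N}"
    proof cases
      case 1
      then show ?thesis
        using cusco_mapD(5)[OF \<Phi> N] V x xN
        by (intro exI[of _ "V \<inter> {x \<in> topspace X. \<Phi> x \<subseteq> N}"]) (auto simp: \<Theta>_def)
    next
      case 2
      have cl: "V \<subseteq> X closure_of V" using V by (simp add: closure_of_subset openin_subset)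
      then have "x \<notin> V" using 2 by blast
      then have "c \<in> N" using xN x 2 by (simp add: \<Theta>_def)
      then show ?thesis
        using x 2 cl
        by (intro exI[of _ "topspace X - X closure_of V"]) (auto simp: \<Theta>_def)
    next
      case 3
      define C where "C = convex hull (insert c (\<Phi> x))"
      have C: "compact C" "C \<subseteq> N"
        using cusco_mapD(2)[OF \<Phi> x] 3 x xN by (auto simp: C_def \<Theta>_def compact_convex_hull)
      obtain e where e: "e > 0" "(\<Union>y\<in>C. ball y e) \<subseteq> N"
        using compact_subset_open_imp_ball_epsilon_subset[OF C(1) N C(2)] by blast
      define D where "D = (\<Union>y\<in>C. ball y e)"
      have "convex D"
      proof -
        have "D = (\<Union>y\<in>C. \<Union>b\<in>ball 0 e. {y + b})"
        proof (intro subset_antisym subsetI)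
          fix z assume "z \<in> D"
          then obtain y where "y \<in> C" "z \<in> ball y e" by (auto simp: D_def)
          then have "z - y \<in> ball 0 e" "z \<in> {y + (z - y)}" by (auto simp: dist_norm)
          with \<open>y \<in> C\<close> show "z \<in> (\<Union>y\<in>C. \<Union>b\<in>ball 0 e. {y + b})" by blast
        qed (force simp: D_def dist_norm)
        moreover have "convex \<dots>" by (intro convex_sums) (simp_all add: C_def)
        ultimately show ?thesis by simp
      qed
      have CD: "C \<subseteq> D" using e(1) by (auto simp: D_def)
      have "insert c (\<Phi> x) \<subseteq> C" unfolding C_def by (rule hull_subset)
      have sub: "\<Theta> y \<subseteq> N" if "y \<in> topspace X" "\<Phi> y \<subseteq> D" for y
      proof -
        have "insert c (\<Phi> y) \<subseteq> D" using that \<open>insert c (\<Phi> x) \<subseteq> C\<close> CD by auto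
        then have "convex hull (insert c (\<Phi> y)) \<subseteq> D" using \<open>convex D\<close> by (simp add: hull_minimal)
        moreover have "\<Theta> y \<subseteq> convex hull (insert c (\<Phi> y))"
          using that(1) hull_subset[of "insert c (\<Phi> y)" convex] by (auto simp: \<Theta>_def)
        ultimately show ?thesis using e(2) by (auto simp: D_def)
      qed
      have "open D" by (auto simp: D_def)
      then show ?thesis
        using cusco_mapD(5)[OF \<Phi>, of D] x \<open>insert c (\<Phi> x) \<subseteq> C\<close> CD sub
        by (intro exI[of _ "{x \<in> topspace X. \<Phi> x \<subseteq> D}"]) auto
    qed
  qed
qed

lemma cusco_map_splice_open:
  assumes \<Phi>: "cusco_map X \<Phi>" and \<Psi>: "cusco_map X \<Psi>" and V: "openin X V"
    and sub: "\<And>x. x \<in> V \<Longrightarrow> \<Psi> x \<subseteq> \<Phi> x"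
  shows "cusco_map X (\<lambda>x. if x \<in> V then \<Psi> x else \<Phi> x)"
  unfolding cusco_map_def
proof (intro conjI ballI allI impI)
  show "(\<lambda>x. if x \<in> V then \<Psi> x else \<Phi> x) \<in> extensional (topspace X)"
    using cusco_mapD(4)[OF \<Phi>] openin_subset[OF V] by (auto simp: extensional_def)
  fix N :: "real set" assume N: "open N"
  have "{x \<in> topspace X. (if x \<in> V then \<Psi> x else \<Phi> x) \<subseteq> N} =
      (V \<inter> {x \<in> topspace X. \<Psi> x \<subseteq> N}) \<union> {x \<in> topspace X. \<Phi> x \<subseteq> N}"
    using sub by auto
  moreover have "openin X \<dots>"
    using cusco_mapD(5)[OF \<Phi> N] cusco_mapD(5)[OF \<Psi> N] V by blast
  ultimately show "openin X {x \<in> topspace X. (if x \<in> V then \<Psi> x else \<Phi> x) \<subseteq> N}" by simp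
qed (use cusco_mapD[OF \<Phi>] cusco_mapD[OF \<Psi>] in auto)

text \<open>
  Separate \<open>K\<close> from the complement of \<open>U\<close> by an open set \<open>V\<close>, and take a minimal map \<open>\<Psi>\<close> below the one
  that jumps from \<open>\<Phi>\<close> to \<open>c\<close> at the boundary of \<open>V\<close>. On \<open>V\<close> it coincides with \<open>\<Phi>\<close>: otherwise
  replacing \<open>\<Phi>\<close> by \<open>\<Psi>\<close> on \<open>V\<close> would give a cusco map strictly below the minimal map \<open>\<Phi>\<close>.
\<close>

theorem MC_modify_off_open:
  assumes X: "regular_space X" and K: "compactin X K" and U: "openin X U" "K \<subseteq> U"
    and \<Phi>: "\<Phi> \<in> MC X"
  obtains \<Psi> where "\<Psi> \<in> MC X" "\<forall>x\<in>K. \<Psi> x = \<Phi> x" "\<forall>x\<in>topspace X - U. \<Psi> x = {c}"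
proof -
  have "closedin X (topspace X - U)" "disjnt K (topspace X - U)"
    using U by (auto simp: disjnt_def)
  then obtain V W where VW: "openin X V" "openin X W" "K \<subseteq> V" "topspace X - U \<subseteq> W" "disjnt V W"
    using regular_space_compact_closed_separation[OF X K] by metis
  have off: "x \<notin> X closure_of V" if "x \<in> topspace X - U" for x
    using VW that by (auto simp: in_closure_of disjnt_def)
  have cl: "V \<subseteq> X closure_of V" using VW(1) by (simp add: closure_of_subset openin_subset)
  note \<Phi>c = MC_imp_cusco_map[OF \<Phi>]
  obtain \<Psi> where \<Psi>: "\<Psi> \<in> MC X" and below: "\<And>x. x \<in> topspace X \<Longrightarrow>
      \<Psi> x \<subseteq> restrict (\<lambda>x. if x \<in> V then \<Phi> x else if x \<in> X closure_of V
      then convex hull (insert c (\<Phi> x)) else {c}) (topspace X) x"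
    using ex_minimal_cusco_below[OF cusco_map_hull_on_closed_nbhd[OF \<Phi>c VW(1)]] by blast
  note \<Psi>c = MC_imp_cusco_map[OF \<Psi>]
  have VX: "V \<subseteq> topspace X" using VW(1) by (rule openin_subset)
  have onV: "\<Psi> x \<subseteq> \<Phi> x" if "x \<in> V" for x using below[of x] that VX by auto
  have eq: "(\<lambda>x. if x \<in> V then \<Psi> x else \<Phi> x) = \<Phi>"
    by (rule MC_minimal[OF \<Phi> cusco_map_splice_open[OF \<Phi>c \<Psi>c VW(1) onV]]) (use onV in auto)
  show ?thesis
  proof (rule that[OF \<Psi>]; intro ballI)
    show "\<Psi> x = \<Phi> x" if "x \<in> K" for x using fun_cong[OF eq, of x] that VW(3) by auto
    show "\<Psi> x = {c}" if x: "x \<in> topspace X - U" for x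
    proof -
      have "x \<notin> V" using off[OF x] cl by blast
      then have "\<Psi> x \<subseteq> {c}" using below[of x] off[OF x] x by simp
      then show ?thesis using cusco_mapD(1)[OF \<Psi>c, of x] x by blast
    qed
  qed
qed

section \<open>Uniform convergence on the members of the family\<close>

definition zero_tube :: "'a topology \<Rightarrow> 'a set \<Rightarrow> real \<Rightarrow> ('a \<Rightarrow> real set) set" where
  "zero_tube X A r = {\<Phi> \<in> MC X. \<forall>x\<in>A. \<Phi> x \<subseteq> ball 0 r}"

lemma W_MC_zero_iff:
  assumes "A \<subseteq> topspace X"
  shows "(zero_MC X, \<Phi>) \<in> W_MC X A r \<longleftrightarrow> \<Phi> \<in> zero_tube X A r"
proof -
  have "({0} \<subseteq> (\<Union>y\<in>\<Phi> x. ball y r) \<and> \<Phi> x \<subseteq> ball 0 r) \<longleftrightarrow> \<Phi> x \<subseteq> ball 0 r"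
    if x: "x \<in> A" and \<Phi>: "\<Phi> \<in> MC X" for x
  proof -
    obtain y where "y \<in> \<Phi> x" using cusco_mapD(1)[OF MC_imp_cusco_map[OF \<Phi>]] x assms by blast
    then show ?thesis by (auto intro!: bexI[of _ y])
  qed
  moreover have "zero_MC X x = {0}" if "x \<in> A" for x
    using that assms by (auto simp: zero_MC_def)
  ultimately show ?thesis
    using zero_MC_in_MC by (auto simp: W_MC_def zero_tube_def)
qed

lemma W_MC_agree:
  assumes "\<Phi> \<in> MC X" "\<Psi> \<in> MC X" "\<forall>x\<in>A. \<Psi> x = \<Phi> x" "0 < r"
  shows "(\<Phi>, \<Psi>) \<in> W_MC X A r"
  using assms by (auto simp: W_MC_def)

context proper_compact_family
begin

lemma openin_MC_top_iff:
  "openin (MC_top X \<A>) S \<longleftrightarrow> S \<subseteq> MC X \<and>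
     (\<forall>\<Phi>\<in>S. \<exists>A\<in>\<A>. \<exists>\<epsilon>>0. {\<Psi> \<in> MC X. (\<Phi>, \<Psi>) \<in> W_MC X A \<epsilon>} \<subseteq> S)"
  using Un_member by (rule openin_MC_top)

lemma ex_member: obtains A where "A \<in> \<A>"
  using nonempty singleton_member by blast

lemma topspace_MC_top [simp]: "topspace (MC_top X \<A>) = MC X"
proof (rule subset_antisym)
  show "topspace (MC_top X \<A>) \<subseteq> MC X"
    using openin_topspace[of "MC_top X \<A>"] openin_MC_top_iff by blast
  obtain A where "A \<in> \<A>" by (rule ex_member)
  then have "openin (MC_top X \<A>) (MC X)"
    unfolding openin_MC_top_iff by (auto intro!: bexI[of _ A] exI[of _ 1])
  then show "MC X \<subseteq> topspace (MC_top X \<A>)" by (rule openin_subset)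
qed

lemma zero_in_zero_tube: "A \<subseteq> topspace X \<Longrightarrow> 0 < r \<Longrightarrow> zero_MC X \<in> zero_tube X A r"
  using zero_MC_in_MC by (auto simp: zero_tube_def zero_MC_def)

text \<open>
  On the compact set \<open>A\<close> the values of \<open>\<Phi>\<close> lie in a ball of some radius smaller than \<open>r\<close>, and the
  difference of the radii is room for all maps close to \<open>\<Phi>\<close>.
\<close>

lemma openin_zero_tube:
  assumes A: "A \<in> \<A>"
  shows "openin (MC_top X \<A>) (zero_tube X A r)"
  unfolding openin_MC_top_iff
proof (intro conjI ballI)
  show "zero_tube X A r \<subseteq> MC X" by (auto simp: zero_tube_def)
  fix \<Phi> assume \<Phi>: "\<Phi> \<in> zero_tube X A r"
  then have \<Phi>M: "\<Phi> \<in> MC X" and sub: "\<And>x. x \<in> A \<Longrightarrow> \<Phi> x \<subseteq> ball 0 r"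
    by (auto simp: zero_tube_def)
  have un: "ball 0 r \<subseteq> (\<Union>n. ball (0 :: real) (r - inverse (Suc n)))"
  proof
    fix y :: real assume "y \<in> ball 0 r"
    then obtain n where "inverse (Suc n) < r - \<bar>y\<bar>"
      using reals_Archimedean[of "r - \<bar>y\<bar>"] by auto
    then have "y \<in> ball 0 (r - inverse (Suc n))" by simp
    then show "y \<in> (\<Union>n. ball 0 (r - inverse (Suc n)))" by blast
  qed
  obtain n where n: "\<And>x. x \<in> A \<Longrightarrow> \<Phi> x \<subseteq> ball 0 (r - inverse (Suc n))"
  proof (rule cusco_map_compact_uniform[OF MC_imp_cusco_map[OF \<Phi>M] compact_member[OF A],
        of "\<lambda>n. ball 0 (r - inverse (Suc n))"])
    show "ball (0 :: real) (r - inverse (Suc m)) \<subseteq> ball 0 (r - inverse (Suc n))" if "m \<le> n" for m n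
      using that by (intro subset_ball) (simp add: le_imp_inverse_le)
    show "\<Phi> x \<subseteq> (\<Union>n. ball 0 (r - inverse (Suc n)))" if "x \<in> A" for x
      using sub[OF that] un by (rule subset_trans)
  qed auto
  have "{\<Psi> \<in> MC X. (\<Phi>, \<Psi>) \<in> W_MC X A (inverse (Suc n))} \<subseteq> zero_tube X A r"
  proof
    fix \<Psi> assume \<Psi>: "\<Psi> \<in> {\<Psi> \<in> MC X. (\<Phi>, \<Psi>) \<in> W_MC X A (inverse (Suc n))}"
    have "y \<in> ball 0 r" if x: "x \<in> A" "y \<in> \<Psi> x" for x y
    proof -
      have "\<Psi> x \<subseteq> (\<Union>z\<in>\<Phi> x. ball z (inverse (Suc n)))"
        using \<Psi> x(1) by (simp add: W_MC_def)
      then obtain z where "z \<in> \<Phi> x" "y \<in> ball z (inverse (Suc n))" using x(2) by blast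
      then have "\<bar>z\<bar> < r - inverse (Suc n)" "\<bar>z - y\<bar> < inverse (Suc n)"
        using n[OF x(1)] by (auto simp: dist_real_def)
      then show ?thesis by simp
    qed
    with \<Psi> show "\<Psi> \<in> zero_tube X A r" by (auto simp: zero_tube_def)
  qed
  then show "\<exists>B\<in>\<A>. \<exists>\<epsilon>>0. {\<Psi> \<in> MC X. (\<Phi>, \<Psi>) \<in> W_MC X B \<epsilon>} \<subseteq> zero_tube X A r"
    using A by (intro bexI[of _ A] exI[of _ "inverse (Suc n)"]) auto
qed

lemma open_nbhd_contains_zero_tube:
  assumes "openin (MC_top X \<A>) S" "zero_MC X \<in> S"
  obtains A r where "A \<in> \<A>" "0 < r" "zero_tube X A r \<subseteq> S"
proof -
  obtain A r where A: "A \<in> \<A>" "0 < r" "{\<Psi> \<in> MC X. (zero_MC X, \<Psi>) \<in> W_MC X A r} \<subseteq> S"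
    using assms unfolding openin_MC_top_iff by blast
  then have "zero_tube X A r \<subseteq> S"
    using W_MC_zero_iff[OF member_subset[OF A(1)]] by (auto simp: zero_tube_def)
  with A that show ?thesis by blast
qed

lemma clustering_sets_zero_iff:
  "S \<in> clustering_sets (MC_top X \<A>) (zero_MC X) \<longleftrightarrow>
     S \<subseteq> MC X \<and> (\<forall>A\<in>\<A>. \<forall>r>0. S \<inter> zero_tube X A r \<noteq> {})"
proof -
  have "zero_MC X \<in> MC_top X \<A> closure_of S \<longleftrightarrow> (\<forall>A\<in>\<A>. \<forall>r>0. S \<inter> zero_tube X A r \<noteq> {})"
  proof
    assume cl: "zero_MC X \<in> MC_top X \<A> closure_of S"
    show "\<forall>A\<in>\<A>. \<forall>r>0. S \<inter> zero_tube X A r \<noteq> {}"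
    proof (intro ballI allI impI)
      fix A and r :: real assume A: "A \<in> \<A>" "0 < r"
      then have "zero_MC X \<in> zero_tube X A r" using zero_in_zero_tube member_subset by blast
      with cl openin_zero_tube[OF A(1)] show "S \<inter> zero_tube X A r \<noteq> {}"
        unfolding in_closure_of by blast
    qed
  next
    assume *: "\<forall>A\<in>\<A>. \<forall>r>0. S \<inter> zero_tube X A r \<noteq> {}"
    show "zero_MC X \<in> MC_top X \<A> closure_of S"
      unfolding in_closure_of
    proof (intro conjI allI impI)
      show "zero_MC X \<in> topspace (MC_top X \<A>)" by (simp add: zero_MC_in_MC)
      fix T assume "zero_MC X \<in> T \<and> openin (MC_top X \<A>) T"
      then obtain A r where "A \<in> \<A>" "0 < r" "zero_tube X A r \<subseteq> T"
        using open_nbhd_contains_zero_tube by metis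
      with * show "\<exists>y. y \<in> S \<and> y \<in> T" by blast
    qed
  qed
  then show ?thesis by (simp add: clustering_sets_def)
qed

lemma MC_modify:
  assumes "A \<in> \<A>" "openin X U" "A \<subseteq> U" "\<Phi> \<in> MC X"
  obtains \<Psi> where "\<Psi> \<in> MC X" "\<forall>x\<in>A. \<Psi> x = \<Phi> x" "\<forall>x\<in>topspace X - U. \<Psi> x = {c}"
  by (rule MC_modify_off_open[OF regular compact_member[OF assms(1)] assms(2-4)])

text \<open>
  Two distinct maps differ at a point \<open>x\<close>, and compact sets that are within every distance of each
  other are equal; hence a neighbourhood given by \<open>{x}\<close> tells the maps apart.
\<close>

lemma t1_space_MC_top: "t1_space (MC_top X \<A>)"
  unfolding t1_space_closedin_singleton
proof
  fix \<Psi> assume "\<Psi> \<in> topspace (MC_top X \<A>)"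
  then have \<Psi>: "\<Psi> \<in> MC X" by simp
  have "openin (MC_top X \<A>) (MC X - {\<Psi>})"
    unfolding openin_MC_top_iff
  proof (intro conjI ballI)
    fix \<Phi> assume \<Phi>: "\<Phi> \<in> MC X - {\<Psi>}"
    then have c: "cusco_map X \<Phi>" "cusco_map X \<Psi>" using \<Psi> by (auto intro: MC_imp_cusco_map)
    obtain x where x: "x \<in> topspace X" "\<Phi> x \<noteq> \<Psi> x"
      using cusco_map_ext[OF c(1) c(2)] \<Phi> by blast
    have closed: "closed (\<Phi> x)" "closed (\<Psi> x)"
      using cusco_mapD(2)[OF c(1) x(1)] cusco_mapD(2)[OF c(2) x(1)] by (auto intro: compact_imp_closed)
    have sub: "S \<subseteq> T" if "closed T" "\<And>\<epsilon>. 0 < \<epsilon> \<Longrightarrow> S \<subseteq> (\<Union>y\<in>T. ball y \<epsilon>)" for S T :: "real set"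
    proof
      fix s assume "s \<in> S"
      then have "\<exists>y\<in>T. dist y s < \<epsilon>" if "0 < \<epsilon>" for \<epsilon> using \<open>0 < \<epsilon> \<Longrightarrow> S \<subseteq> (\<Union>y\<in>T. ball y \<epsilon>)\<close> that by force
      then have "s \<in> closure T" by (simp add: closure_approachable)
      then show "s \<in> T" using \<open>closed T\<close> by simp
    qed
    have "\<exists>\<epsilon>>0. \<not> (\<Phi> x \<subseteq> (\<Union>y\<in>\<Psi> x. ball y \<epsilon>) \<and> \<Psi> x \<subseteq> (\<Union>y\<in>\<Phi> x. ball y \<epsilon>))"
    proof (rule ccontr)
      assume "\<not> ?thesis"
      then have near: "\<Phi> x \<subseteq> (\<Union>y\<in>\<Psi> x. ball y \<epsilon>)" "\<Psi> x \<subseteq> (\<Union>y\<in>\<Phi> x. ball y \<epsilon>)"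
        if "0 < \<epsilon>" for \<epsilon> using that by simp_all
      have "\<Phi> x = \<Psi> x"
        using sub[OF closed(2) near(1)] sub[OF closed(1) near(2)] by (rule subset_antisym)
      with x show False by simp
    qed
    then obtain \<epsilon> where "\<epsilon> > 0" "(\<Phi>, \<Psi>) \<notin> W_MC X {x} \<epsilon>" by (auto simp: W_MC_def)
    then show "\<exists>A\<in>\<A>. \<exists>\<epsilon>>0. {\<Psi>' \<in> MC X. (\<Phi>, \<Psi>') \<in> W_MC X A \<epsilon>} \<subseteq> MC X - {\<Psi>}"
      using singleton_member[OF x(1)] by (intro bexI[of _ "{x}"] exI[of _ \<epsilon>]) auto
  qed auto
  then show "closedin (MC_top X \<A>) {\<Psi>}" using \<Psi> by (simp add: closedin_def)
qed

end

section \<open>Fan tightness and games on minimal cusco maps\<close>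

context proper_compact_family
begin

abbreviation "MCA \<equiv> MC_top X \<A>"

abbreviation "covers \<equiv> family_covers X \<A>"

lemma zero_tube_in_nhds_pt:
  assumes A: "A \<in> \<A>" and r: "0 < r" "r \<le> 1"
  shows "zero_tube X A r \<in> nhds_pt MCA (zero_MC X)"
proof -
  obtain x where "x \<in> A" using nonempty_member[OF A] by blast
  then have "const_MC X 1 x = {1}" using member_subset[OF A] by (auto simp: const_MC_def)
  then have "const_MC X 1 \<notin> zero_tube X A r" using \<open>x \<in> A\<close> r by (force simp: zero_tube_def)
  moreover have "const_MC X 1 \<in> MC X" by (rule const_MC_in_MC)
  ultimately have "zero_tube X A r \<noteq> MC X" by blast
  then show ?thesis
    using openin_zero_tube[OF A, of r] zero_in_zero_tube[OF member_subset[OF A] r(1)]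
    by (auto simp: nhds_pt_def proper_opens_def)
qed

text \<open>
  The tube contains a map that is \<open>\<zero>\<close> on \<open>A\<close> and \<open>{1}\<close> at a point outside of \<open>A\<close>.
\<close>

lemma punctured_zero_tube_in_proper_opens:
  assumes A: "A \<in> \<A>" and r: "0 < r"
  shows "zero_tube X A r - {zero_MC X} \<in> proper_opens MCA"
proof -
  have "openin MCA (zero_tube X A r - {zero_MC X})"
    using t1_space_MC_top openin_zero_tube[OF A, of r] by (simp add: t1_space_openin_delete_alt)
  moreover have "zero_tube X A r - {zero_MC X} \<noteq> {}"
  proof -
    obtain x where x: "x \<in> topspace X" "x \<notin> A" using A by (rule member_misses_point)
    have "openin X (topspace X - {x})" using openin_delete by simp
    moreover have "A \<subseteq> topspace X - {x}" using member_subset[OF A] x by blast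
    ultimately obtain \<Psi> where \<Psi>: "\<Psi> \<in> MC X" "\<forall>y\<in>A. \<Psi> y = zero_MC X y"
        "\<forall>y\<in>topspace X - (topspace X - {x}). \<Psi> y = {1}"
      by (rule MC_modify[OF A _ _ zero_MC_in_MC])
    have "\<Psi> x = {1}" using \<Psi>(3) x by simp
    moreover have "zero_MC X x = {0}" using x by (simp add: zero_MC_def)
    ultimately have "\<Psi> x \<noteq> zero_MC X x" by simp
    then have "\<Psi> \<noteq> zero_MC X" by (rule contrapos_nn) (rule fun_cong)
    moreover have "\<Psi> \<in> zero_tube X A r"
      using \<Psi>(1,2) zero_in_zero_tube[OF member_subset[OF A] r] by (simp add: zero_tube_def)
    ultimately show ?thesis by blast
  qed
  moreover have "zero_MC X \<in> topspace MCA" using zero_MC_in_MC by simp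
  ultimately show ?thesis by (auto simp: proper_opens_def)
qed

text \<open>
  Think of \<open>F s A\<close> as the map that Two returns in position \<open>s\<close> when One asks for values close to
  \<open>0\<close> on \<open>A\<close>. The points where this map is small form an open set containing \<open>A\<close>. Along a
  branch where every \<open>A\<close> is contained in such sets infinitely often, this happens for arbitrarily
  small radii, so the maps cluster at \<open>\<zero>\<close>.
\<close>

lemma S1_beats_function_choices:
  fixes F :: "'a set list \<Rightarrow> 'a set \<Rightarrow> 'a \<Rightarrow> real set"
  assumes S1: "S1 covers covers"
    and F: "\<And>s A. set s \<subseteq> \<A> \<Longrightarrow> A \<in> \<A> \<Longrightarrow> F s A \<in> zero_tube X A (inverse (Suc (length s)))"
  obtains g where "\<forall>n. g n \<in> \<A>"
    "range (\<lambda>n. F (map g [0..<n]) (g n)) \<in> clustering_sets MCA (zero_MC X)"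
proof -
  define U where "U s A = (if set s \<subseteq> \<A>
      then {x \<in> topspace X. F s A x \<subseteq> ball 0 (inverse (Suc (length s)))} else topspace X)" for s A
  have FM: "F s A \<in> MC X" if "set s \<subseteq> \<A>" "A \<in> \<A>" for s A
    using F[OF that] by (simp add: zero_tube_def)
  obtain g where g: "\<And>n. g n \<in> \<A>"
      "\<And>A. A \<in> \<A> \<Longrightarrow> infinite {n. A \<subseteq> U (map g [0..<n]) (g n)}"
  proof (rule S1_family_covers_beats_game[OF S1, of "\<lambda>_. \<A>" U])
    show "openin X (U s A)" if "A \<in> \<A>" for s A
      using cusco_mapD(5)[OF MC_imp_cusco_map[OF FM[OF _ that]]] by (simp add: U_def)
    show "\<exists>B\<in>\<A>. A \<subseteq> U s B" if "A \<in> \<A>" for s A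
      using F[of s A] that member_subset[OF that]
      by (intro bexI[of _ A]) (auto simp: U_def zero_tube_def)
  qed auto
  have sub: "set (map g [0..<n]) \<subseteq> \<A>" for n using g(1) by auto
  have "range (\<lambda>n. F (map g [0..<n]) (g n)) \<inter> zero_tube X A r \<noteq> {}"
    if A: "A \<in> \<A>" and r: "0 < r" for A r
  proof -
    obtain k where k: "inverse (real (Suc k)) < r" using reals_Archimedean[OF r] by blast
    obtain n where n: "k \<le> n" "A \<subseteq> U (map g [0..<n]) (g n)"
      using g(2)[OF A] unfolding infinite_nat_iff_unbounded_le by blast
    have "inverse (real (Suc n)) \<le> inverse (real (Suc k))"
      using n(1) by (simp add: le_imp_inverse_le)
    with k have "inverse (real (Suc n)) \<le> r" by linarith
    then have "ball (0 :: real) (inverse (Suc n)) \<subseteq> ball 0 r" by (rule subset_ball)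
    moreover have "F (map g [0..<n]) (g n) x \<subseteq> ball 0 (inverse (Suc n))" if "x \<in> A" for x
      using subsetD[OF n(2) that] sub[of n] by (simp add: U_def split: if_splits)
    ultimately have "F (map g [0..<n]) (g n) \<in> zero_tube X A r"
      using FM[OF sub g(1)] unfolding zero_tube_def by blast
    then show ?thesis by blast
  qed
  then have "range (\<lambda>n. F (map g [0..<n]) (g n)) \<in> clustering_sets MCA (zero_MC X)"
    using FM[OF sub g(1)] by (auto simp: clustering_sets_zero_iff)
  then show ?thesis by (intro that[of g]) (simp_all add: g(1))
qed

lemma S1_imp_strong_countable_fan_tightness:
  assumes S1: "S1 covers covers"
  shows "strong_countable_fan_tightness_at MCA (zero_MC X)"
  unfolding strong_countable_fan_tightness_at_def S1_def
proof (intro allI impI)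
  fix S :: "nat \<Rightarrow> ('a \<Rightarrow> real set) set"
  assume S: "\<forall>n. S n \<in> clustering_sets MCA (zero_MC X)"
  define F where "F s A = (SOME \<Phi>. \<Phi> \<in> S (length s) \<inter> zero_tube X A (inverse (Suc (length s))))"
    for s :: "'a set list" and A
  have F: "F s A \<in> S (length s) \<inter> zero_tube X A (inverse (Suc (length s)))" if "A \<in> \<A>" for s A
  proof -
    have "S (length s) \<inter> zero_tube X A (inverse (Suc (length s))) \<noteq> {}"
      using S that unfolding clustering_sets_zero_iff by simp
    then show ?thesis unfolding F_def by (rule some_in_eq[THEN iffD2])
  qed
  obtain g where g: "\<forall>n. g n \<in> \<A>"
      "range (\<lambda>n. F (map g [0..<n]) (g n)) \<in> clustering_sets MCA (zero_MC X)"
    by (rule S1_beats_function_choices[OF S1, of F]) (use F in auto)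
  have "F (map g [0..<n]) (g n) \<in> S n" for n
    using F[OF g(1)[rule_format, of n], of "map g [0..<n]"] by simp
  with g(2) show "\<exists>x. (\<forall>n. x n \<in> S n) \<and> range x \<in> clustering_sets MCA (zero_MC X)"
    by (intro exI[of _ "\<lambda>n. F (map g [0..<n]) (g n)"]) simp
qed

lemma strong_countable_fan_tightness_imp_dense:
  assumes "strong_countable_fan_tightness_at MCA (zero_MC X)"
  shows "strong_countable_dense_fan_tightness_at MCA (zero_MC X)"
proof -
  have "dense_sets MCA \<subseteq> clustering_sets MCA (zero_MC X)"
    using zero_MC_in_MC by (auto simp: dense_sets_def clustering_sets_def)
  with assms show ?thesis
    unfolding strong_countable_fan_tightness_at_def strong_countable_dense_fan_tightness_at_def S1_def
    by blast
qed

text \<open>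
  By modification off a member of \<open>\<U>\<^sub>n\<close>, the maps that are \<open>{1}\<close> off some member of \<open>\<U>\<^sub>n\<close> are
  dense. If a selection of such maps clusters at \<open>\<zero>\<close>, then for every \<open>A\<close> one of them is smaller
  than \<open>1\<close> on \<open>A\<close>, and the corresponding member of \<open>\<U>\<^sub>n\<close> contains \<open>A\<close>.
\<close>

lemma dense_fan_tightness_imp_S1:
  assumes dense: "strong_countable_dense_fan_tightness_at MCA (zero_MC X)"
  shows "S1 covers covers"
proof (rule ccontr)
  assume "\<not> S1 covers covers"
  then obtain \<U> where \<U>: "\<And>n::nat. \<U> n \<in> covers"
    "\<And>U. (\<And>n. U n \<in> \<U> n) \<Longrightarrow> \<exists>A\<in>\<A>. \<forall>n. \<not> A \<subseteq> U n"
    by (rule not_S1_bad_covers) blast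
  define D where "D n = {\<Psi> \<in> MC X. \<exists>U\<in>\<U> n. \<forall>x\<in>topspace X - U. \<Psi> x = {1}}" for n
  have "D n \<in> dense_sets MCA" for n
  proof -
    have "\<Phi> \<in> MCA closure_of D n" if \<Phi>: "\<Phi> \<in> MC X" for \<Phi>
      unfolding in_closure_of
    proof (intro conjI allI impI)
      show "\<Phi> \<in> topspace MCA" using \<Phi> by simp
      fix T assume T: "\<Phi> \<in> T \<and> openin MCA T"
      then obtain A r where A: "A \<in> \<A>" "0 < r" "{\<Psi> \<in> MC X. (\<Phi>, \<Psi>) \<in> W_MC X A r} \<subseteq> T"
        unfolding openin_MC_top_iff by blast
      obtain U where U: "U \<in> \<U> n" "A \<subseteq> U" using family_coversD(2)[OF \<U>(1) A(1)] by blast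
      have "openin X U" using family_coversD(1)[OF \<U>(1) U(1)] by (simp add: proper_opens_def)
      then obtain \<Psi> where \<Psi>: "\<Psi> \<in> MC X" "\<forall>x\<in>A. \<Psi> x = \<Phi> x"
          "\<forall>x\<in>topspace X - U. \<Psi> x = {1}"
        by (rule MC_modify[OF A(1) _ U(2) \<Phi>])
      then have "\<Psi> \<in> T" using W_MC_agree[OF \<Phi> \<Psi>(1,2) A(2)] A(3) by blast
      moreover have "\<Psi> \<in> D n" using \<Psi> U(1) by (auto simp: D_def)
      ultimately show "\<exists>\<Psi>. \<Psi> \<in> D n \<and> \<Psi> \<in> T" by blast
    qed
    moreover have "D n \<subseteq> MC X" by (auto simp: D_def)
    ultimately show ?thesis
      using closure_of_subset_topspace[of MCA "D n"] by (auto simp: dense_sets_def)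
  qed
  then obtain \<Psi> where \<Psi>: "\<And>n. \<Psi> n \<in> D n" "range \<Psi> \<in> clustering_sets MCA (zero_MC X)"
    using dense unfolding strong_countable_dense_fan_tightness_at_def S1_def by blast
  have "\<forall>n. \<exists>U. U \<in> \<U> n \<and> (\<forall>x\<in>topspace X - U. \<Psi> n x = {1})"
  proof
    show "\<exists>U. U \<in> \<U> n \<and> (\<forall>x\<in>topspace X - U. \<Psi> n x = {1})" for n
      using \<Psi>(1)[of n] by (simp add: D_def Bex_def)
  qed
  then obtain U where U: "\<forall>n. U n \<in> \<U> n \<and> (\<forall>x\<in>topspace X - U n. \<Psi> n x = {1})"
    by (rule choice[THEN exE])
  have "\<exists>A\<in>\<A>. \<forall>n. \<not> A \<subseteq> U n" by (rule \<U>(2)) (simp add: U)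
  then obtain A where A: "A \<in> \<A>" "\<And>n. \<not> A \<subseteq> U n" by blast
  obtain n where n: "\<Psi> n \<in> zero_tube X A 1"
  proof -
    have "range \<Psi> \<inter> zero_tube X A 1 \<noteq> {}"
      using \<Psi>(2) A(1) unfolding clustering_sets_zero_iff by simp
    with that show ?thesis by blast
  qed
  obtain x where "x \<in> A" "x \<notin> U n" using A(2) by blast
  then have "\<Psi> n x = {1}" "\<Psi> n x \<subseteq> ball 0 1"
    using U member_subset[OF A(1)] n by (auto simp: zero_tube_def)
  then show False by simp
qed

text \<open>
  One plays the \<open>n\<close>-th set of \<open>\<A>\<close> through its neighbourhood \<open>T n\<close>; the members of \<open>\<A>\<close> rather than the
  sets offered to Two serve as the moves of the tree.
\<close>

lemma S1_clusters_against_Two: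
  fixes T :: "nat \<Rightarrow> 'a set \<Rightarrow> ('a \<Rightarrow> real set) set"
  assumes S1: "S1 covers covers"
    and \<tau>: "\<And>s. s \<noteq> [] \<Longrightarrow> set s \<subseteq> C \<Longrightarrow> \<tau> s \<in> last s"
    and T: "\<And>i A. A \<in> \<A> \<Longrightarrow> T i A \<in> C"
      "\<And>i A. A \<in> \<A> \<Longrightarrow> T i A \<subseteq> zero_tube X A (inverse (Suc i))"
  obtains g where "\<forall>n. g n \<in> \<A>"
    "range (\<lambda>n. \<tau> (map (\<lambda>i. T i (g i)) [0..<Suc n])) \<in> clustering_sets MCA (zero_MC X)"
proof -
  define moves where "moves s = map (\<lambda>i. T i (s ! i)) [0..<length s]" for s :: "'a set list"
  have moves_legal: "set (moves s) \<subseteq> C" if "set s \<subseteq> \<A>" for s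
    using that T(1) nth_mem by (fastforce simp: moves_def)
  have "\<tau> (moves (s @ [A])) \<in> zero_tube X A (inverse (Suc (length s)))"
    if "set s \<subseteq> \<A>" "A \<in> \<A>" for s A
  proof -
    have "\<tau> (moves (s @ [A])) \<in> last (moves (s @ [A]))"
      using that by (intro \<tau> moves_legal) (auto simp: moves_def)
    then have "\<tau> (moves (s @ [A])) \<in> T (length s) A" by (simp add: moves_def)
    then show ?thesis using T(2)[OF that(2)] by blast
  qed
  then obtain g where g: "\<forall>n. g n \<in> \<A>"
      "range (\<lambda>n. \<tau> (moves (map g [0..<n] @ [g n]))) \<in> clustering_sets MCA (zero_MC X)"
    by (rule S1_beats_function_choices[OF S1, of "\<lambda>s A. \<tau> (moves (s @ [A]))"])
  have "moves (map g [0..<n] @ [g n]) = map (\<lambda>i. T i (g i)) [0..<Suc n]" for n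
    unfolding moves_def by (rule nth_equalityI) (auto simp: nth_append less_Suc_eq)
  with g(2) have "range (\<lambda>n. \<tau> (map (\<lambda>i. T i (g i)) [0..<Suc n])) \<in> clustering_sets MCA (zero_MC X)"
    by simp
  with g(1) show ?thesis by (rule that)
qed

lemma S1_imp_not_Two_wins_nhds_pt_game:
  assumes S1: "S1 covers covers"
  shows "\<not> Two_wins_G1 (nhds_pt MCA (zero_MC X)) (- clustering_sets MCA (zero_MC X))"
proof
  assume "Two_wins_G1 (nhds_pt MCA (zero_MC X)) (- clustering_sets MCA (zero_MC X))"
  then obtain \<tau> where \<tau>: "\<And>s. s \<noteq> [] \<Longrightarrow> set s \<subseteq> nhds_pt MCA (zero_MC X) \<Longrightarrow> \<tau> s \<in> last s"
      "\<And>N. (\<And>n::nat. N n \<in> nhds_pt MCA (zero_MC X)) \<Longrightarrow>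
         range (\<lambda>n. \<tau> (map N [0..<Suc n])) \<notin> clustering_sets MCA (zero_MC X)"
    by (auto simp: Two_wins_G1_def winning_strategy_Two_def)
  let ?T = "\<lambda>i A. zero_tube X A (inverse (real (Suc i)))"
  have T: "?T i A \<in> nhds_pt MCA (zero_MC X)" if "A \<in> \<A>" for i A
    using that by (intro zero_tube_in_nhds_pt) (auto simp: inverse_le_1_iff)
  obtain g where g: "\<forall>n. g n \<in> \<A>"
      "range (\<lambda>n. \<tau> (map (\<lambda>i. ?T i (g i)) [0..<Suc n])) \<in> clustering_sets MCA (zero_MC X)"
    by (rule S1_clusters_against_Two[OF S1 \<tau>(1) T subset_refl])
  moreover have "range (\<lambda>n. \<tau> (map (\<lambda>i. ?T i (g i)) [0..<Suc n])) \<notin> clustering_sets MCA (zero_MC X)"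
    by (rule \<tau>(2)) (rule T[OF g(1)[rule_format]])
  ultimately show False by blast
qed

text \<open>
  Two answers a neighbourhood of \<open>\<zero>\<close>, which contains a tube over some \<open>A\<close>, by a map that is \<open>\<zero>\<close>
  on \<open>A\<close> and \<open>{1}\<close> off a member of \<open>\<U>\<^sub>n\<close>. Some member of \<open>\<A>\<close> escapes all the chosen members of
  the covers, and the tube of radius \<open>1\<close> over it contains none of Two's answers.
\<close>

lemma not_S1_imp_Two_wins_Markov_nhds_pt_game:
  assumes "\<not> S1 covers covers"
  shows "Two_wins_G1_Markov (nhds_pt MCA (zero_MC X)) (- clustering_sets MCA (zero_MC X))"
proof -
  obtain \<U> where \<U>: "\<And>n::nat. \<U> n \<in> covers"
    "\<And>U. (\<And>n. U n \<in> \<U> n) \<Longrightarrow> \<exists>A\<in>\<A>. \<forall>n. \<not> A \<subseteq> U n"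
    using assms by (rule not_S1_bad_covers) blast
  have response: "\<exists>\<Psi>. \<Psi> \<in> N \<and> \<Psi> \<in> MC X \<and> (\<exists>U\<in>\<U> n. \<forall>x\<in>topspace X - U. \<Psi> x = {1})"
    if N: "N \<in> nhds_pt MCA (zero_MC X)" for N n
  proof -
    have "openin MCA N" "zero_MC X \<in> N" using N by (auto simp: nhds_pt_def proper_opens_def)
    then obtain A r where A: "A \<in> \<A>" "0 < r" "zero_tube X A r \<subseteq> N"
      by (rule open_nbhd_contains_zero_tube)
    obtain U where U: "U \<in> \<U> n" "A \<subseteq> U" using family_coversD(2)[OF \<U>(1) A(1)] by blast
    have "openin X U" using family_coversD(1)[OF \<U>(1) U(1)] by (simp add: proper_opens_def)
    then obtain \<Psi> where \<Psi>: "\<Psi> \<in> MC X" "\<forall>x\<in>A. \<Psi> x = zero_MC X x"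
        "\<forall>x\<in>topspace X - U. \<Psi> x = {1}"
      by (rule MC_modify[OF A(1) _ U(2) zero_MC_in_MC])
    have "\<Psi> \<in> zero_tube X A r"
      using \<Psi>(1,2) zero_in_zero_tube[OF member_subset[OF A(1)] A(2)] by (simp add: zero_tube_def)
    with \<Psi> U(1) A(3) show ?thesis by blast
  qed
  define \<tau> where "\<tau> N n = (SOME \<Psi>. \<Psi> \<in> N \<and> \<Psi> \<in> MC X \<and>
      (\<exists>U\<in>\<U> n. \<forall>x\<in>topspace X - U. \<Psi> x = {1}))" for N n
  have \<tau>: "\<tau> N n \<in> N \<and> \<tau> N n \<in> MC X \<and> (\<exists>U\<in>\<U> n. \<forall>x\<in>topspace X - U. \<tau> N n x = {1})"
    if N: "N \<in> nhds_pt MCA (zero_MC X)" for N n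
    unfolding \<tau>_def by (rule someI_ex[OF response[OF N]])
  have "range (\<lambda>n. \<tau> (N n) n) \<notin> clustering_sets MCA (zero_MC X)"
    if N: "\<And>n. N n \<in> nhds_pt MCA (zero_MC X)" for N
  proof
    assume cl: "range (\<lambda>n. \<tau> (N n) n) \<in> clustering_sets MCA (zero_MC X)"
    have "\<forall>n. \<exists>U. U \<in> \<U> n \<and> (\<forall>x\<in>topspace X - U. \<tau> (N n) n x = {1})"
      using \<tau>[OF N] by (simp add: Bex_def)
    then obtain U where U: "\<forall>n. U n \<in> \<U> n \<and> (\<forall>x\<in>topspace X - U n. \<tau> (N n) n x = {1})"
      by (rule choice[THEN exE])
    have "\<exists>A\<in>\<A>. \<forall>n. \<not> A \<subseteq> U n" by (rule \<U>(2)) (simp add: U)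
    then obtain A where A: "A \<in> \<A>" "\<And>n. \<not> A \<subseteq> U n" by blast
    have "range (\<lambda>n. \<tau> (N n) n) \<inter> zero_tube X A 1 \<noteq> {}"
      using cl A(1) unfolding clustering_sets_zero_iff by simp
    then obtain n where n: "\<tau> (N n) n \<in> zero_tube X A 1" by blast
    obtain x where "x \<in> A" "x \<notin> U n" using A(2) by blast
    then have "\<tau> (N n) n x = {1}" "\<tau> (N n) n x \<subseteq> ball 0 1"
      using U member_subset[OF A(1)] n by (auto simp: zero_tube_def)
    then show False by simp
  qed
  with \<tau> have "winning_Markov_strategy_Two (nhds_pt MCA (zero_MC X))
      (- clustering_sets MCA (zero_MC X)) \<tau>"
    by (simp add: winning_Markov_strategy_Two_def)
  then show ?thesis by (auto simp: Two_wins_G1_Markov_def)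
qed

text \<open>
  One offers tubes without \<open>\<zero>\<close>, so Two's answers differ from \<open>\<zero>\<close> but cluster there, and their
  range is not closed.
\<close>

lemma S1_imp_not_Two_wins_open_sets_game:
  assumes S1: "S1 covers covers"
  shows "\<not> Two_wins_G1 (proper_opens MCA) (closed_discrete_sets MCA)"
proof
  assume "Two_wins_G1 (proper_opens MCA) (closed_discrete_sets MCA)"
  then obtain \<tau> where \<tau>: "\<And>s. s \<noteq> [] \<Longrightarrow> set s \<subseteq> proper_opens MCA \<Longrightarrow> \<tau> s \<in> last s"
      "\<And>N. (\<And>n::nat. N n \<in> proper_opens MCA) \<Longrightarrow>
         range (\<lambda>n. \<tau> (map N [0..<Suc n])) \<in> closed_discrete_sets MCA"
    by (auto simp: Two_wins_G1_def winning_strategy_Two_def)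
  let ?T = "\<lambda>i A. zero_tube X A (inverse (real (Suc i))) - {zero_MC X}"
  have T: "?T i A \<in> proper_opens MCA" if "A \<in> \<A>" for i A
    using that by (intro punctured_zero_tube_in_proper_opens) auto
  obtain g where g: "\<forall>n. g n \<in> \<A>"
      "range (\<lambda>n. \<tau> (map (\<lambda>i. ?T i (g i)) [0..<Suc n])) \<in> clustering_sets MCA (zero_MC X)"
    by (rule S1_clusters_against_Two[OF S1 \<tau>(1) T Diff_subset])
  let ?R = "range (\<lambda>n. \<tau> (map (\<lambda>i. ?T i (g i)) [0..<Suc n]))"
  have "?R \<in> closed_discrete_sets MCA"
    by (rule \<tau>(2)) (rule T[OF g(1)[rule_format]])
  then have "MCA closure_of ?R = ?R" by (simp add: closed_discrete_sets_def closure_of_closedin)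
  then have "zero_MC X \<in> ?R" using g(2) by (simp add: clustering_sets_def)
  then obtain n where n: "zero_MC X = \<tau> (map (\<lambda>i. ?T i (g i)) [0..<Suc n])" by blast
  have "\<tau> (map (\<lambda>i. ?T i (g i)) [0..<Suc n]) \<in> last (map (\<lambda>i. ?T i (g i)) [0..<Suc n])"
    using T[OF g(1)[rule_format]] by (intro \<tau>(1)) auto
  with n show False by simp
qed

lemma locally_finite_in_closed_discrete_sets:
  assumes "S \<subseteq> MC X"
    and "\<And>\<Phi>. \<Phi> \<in> MC X \<Longrightarrow> \<exists>T. openin MCA T \<and> \<Phi> \<in> T \<and> finite (S \<inter> T)"
  shows "S \<in> closed_discrete_sets MCA"
proof -
  have "MCA derived_set_of S =
      {\<Phi> \<in> topspace MCA. \<forall>T. \<Phi> \<in> T \<and> openin MCA T \<longrightarrow> infinite (S \<inter> T)}"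
    using t1_space_MC_top by (simp only: t1_space_derived_set_of_infinite_openin)
  moreover have "\<not> (\<forall>T. \<Phi> \<in> T \<and> openin MCA T \<longrightarrow> infinite (S \<inter> T))" if "\<Phi> \<in> MC X" for \<Phi>
    using assms(2)[OF that] by blast
  ultimately have "MCA derived_set_of S = {}" by simp
  with assms(1) show ?thesis
    by (simp add: closed_discrete_sets_def closedin_contains_derived_set
        subtopology_eq_discrete_topology_eq)
qed

text \<open>
  In inning \<open>n\<close> Two takes a map in One's open set and makes it \<open>{n}\<close> off a member of \<open>\<U>\<^sub>n\<close>. Some
  \<open>A \<in> \<A>\<close> escapes all these members, so the \<open>n\<close>-th answer has the value \<open>{n}\<close> somewhere on \<open>A\<close>. Since
  every cusco map is bounded on \<open>A\<close>, it has a neighbourhood that contains only finitely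
  many of the answers.
\<close>

lemma not_S1_imp_Two_wins_Markov_open_sets_game:
  assumes "\<not> S1 covers covers"
  shows "Two_wins_G1_Markov (proper_opens MCA) (closed_discrete_sets MCA)"
proof -
  obtain \<U> where \<U>: "\<And>n::nat. \<U> n \<in> covers"
    "\<And>U. (\<And>n. U n \<in> \<U> n) \<Longrightarrow> \<exists>A\<in>\<A>. \<forall>n. \<not> A \<subseteq> U n"
    using assms by (rule not_S1_bad_covers) blast
  have response: "\<exists>\<Psi>. \<Psi> \<in> N \<and> \<Psi> \<in> MC X \<and> (\<exists>U\<in>\<U> n. \<forall>x\<in>topspace X - U. \<Psi> x = {real n})"
    if N: "N \<in> proper_opens MCA" for N n
  proof -
    obtain \<Phi> where "openin MCA N" "\<Phi> \<in> N" using N by (auto simp: proper_opens_def)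
    then obtain A r where A: "A \<in> \<A>" "0 < r" "{\<Psi> \<in> MC X. (\<Phi>, \<Psi>) \<in> W_MC X A r} \<subseteq> N"
        and \<Phi>: "\<Phi> \<in> MC X"
      unfolding openin_MC_top_iff by blast
    obtain U where U: "U \<in> \<U> n" "A \<subseteq> U" using family_coversD(2)[OF \<U>(1) A(1)] by blast
    have "openin X U" using family_coversD(1)[OF \<U>(1) U(1)] by (simp add: proper_opens_def)
    then obtain \<Psi> where \<Psi>: "\<Psi> \<in> MC X" "\<forall>x\<in>A. \<Psi> x = \<Phi> x"
        "\<forall>x\<in>topspace X - U. \<Psi> x = {real n}"
      by (rule MC_modify[OF A(1) _ U(2) \<Phi>])
    then have "\<Psi> \<in> N" using W_MC_agree[OF \<Phi> \<Psi>(1,2) A(2)] A(3) by blast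
    with \<Psi> U(1) show ?thesis by blast
  qed
  define \<tau> where "\<tau> N n = (SOME \<Psi>. \<Psi> \<in> N \<and> \<Psi> \<in> MC X \<and>
      (\<exists>U\<in>\<U> n. \<forall>x\<in>topspace X - U. \<Psi> x = {real n}))" for N n
  have \<tau>: "\<tau> N n \<in> N \<and> \<tau> N n \<in> MC X \<and> (\<exists>U\<in>\<U> n. \<forall>x\<in>topspace X - U. \<tau> N n x = {real n})"
    if N: "N \<in> proper_opens MCA" for N n
    unfolding \<tau>_def by (rule someI_ex[OF response[OF N]])
  have "range (\<lambda>n. \<tau> (N n) n) \<in> closed_discrete_sets MCA"
    if N: "\<And>n. N n \<in> proper_opens MCA" for N
  proof (rule locally_finite_in_closed_discrete_sets)
    show "range (\<lambda>n. \<tau> (N n) n) \<subseteq> MC X" using \<tau>[OF N] by (simp add: image_subset_iff)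
    have "\<forall>n. \<exists>U. U \<in> \<U> n \<and> (\<forall>x\<in>topspace X - U. \<tau> (N n) n x = {real n})"
      using \<tau>[OF N] by (simp add: Bex_def)
    then obtain U where U: "\<forall>n. U n \<in> \<U> n \<and> (\<forall>x\<in>topspace X - U n. \<tau> (N n) n x = {real n})"
      by (rule choice[THEN exE])
    have "\<exists>A\<in>\<A>. \<forall>n. \<not> A \<subseteq> U n" by (rule \<U>(2)) (simp add: U)
    then obtain A where A: "A \<in> \<A>" "\<And>n. \<not> A \<subseteq> U n" by blast
    fix \<Phi> assume \<Phi>: "\<Phi> \<in> MC X"
    have un: "y \<in> (\<Union>k. ball 0 (real k))" for y :: real
      using reals_Archimedean2[of "\<bar>y\<bar>"] by auto
    obtain k where k: "\<And>x. x \<in> A \<Longrightarrow> \<Phi> x \<subseteq> ball 0 (real k)"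
      by (rule cusco_map_compact_uniform[OF MC_imp_cusco_map[OF \<Phi>] compact_member[OF A(1)],
            of "\<lambda>k. ball 0 (real k)"]) (use un in auto)
    then have "\<Phi> \<in> zero_tube X A (real k)" using \<Phi> by (simp add: zero_tube_def)
    moreover have "range (\<lambda>n. \<tau> (N n) n) \<inter> zero_tube X A (real k) \<subseteq> (\<lambda>n. \<tau> (N n) n) ` {..<k}"
    proof clarify
      fix n assume n: "\<tau> (N n) n \<in> zero_tube X A (real k)"
      obtain x where "x \<in> A" "x \<notin> U n" using A(2) by blast
      then have "\<tau> (N n) n x = {real n}" "\<tau> (N n) n x \<subseteq> ball 0 (real k)"
        using U member_subset[OF A(1)] n by (auto simp: zero_tube_def)
      then have "n < k" by simp
      then show "\<tau> (N n) n \<in> (\<lambda>n. \<tau> (N n) n) ` {..<k}" by blast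
    qed
    then have "finite (range (\<lambda>n. \<tau> (N n) n) \<inter> zero_tube X A (real k))"
      by (rule finite_subset) simp
    ultimately show "\<exists>T. openin MCA T \<and> \<Phi> \<in> T \<and> finite (range (\<lambda>n. \<tau> (N n) n) \<inter> T)"
      using openin_zero_tube[OF A(1)] by blast
  qed
  with \<tau> have "winning_Markov_strategy_Two (proper_opens MCA) (closed_discrete_sets MCA) \<tau>"
    by (simp add: winning_Markov_strategy_Two_def)
  then show ?thesis by (auto simp: Two_wins_G1_Markov_def)
qed

text \<open>
  In each pair of conditions on Two, the selection principle excludes arbitrary strategies, and its
  failure yields a Markov strategy.
\<close>

theorem S1_family_covers_equivalences:
  "S1 covers covers \<longleftrightarrow> \<not> One_wins_G1 covers covers"
  "S1 covers covers \<longleftrightarrow> strong_countable_fan_tightness_at MCA (zero_MC X)"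
  "S1 covers covers \<longleftrightarrow> strong_countable_dense_fan_tightness_at MCA (zero_MC X)"
  "S1 covers covers \<longleftrightarrow> \<not> Two_wins_G1_Markov (nhds_set X ` \<A>) (- covers)"
  "S1 covers covers \<longleftrightarrow> \<not> Two_wins_G1 (nhds_set X ` \<A>) (- covers)"
  "S1 covers covers \<longleftrightarrow> \<not> Two_wins_G1_Markov (proper_opens MCA) (closed_discrete_sets MCA)"
  "S1 covers covers \<longleftrightarrow> \<not> Two_wins_G1 (proper_opens MCA) (closed_discrete_sets MCA)"
  "S1 covers covers \<longleftrightarrow> \<not> Two_wins_G1_Markov (nhds_pt MCA (zero_MC X))
     (- clustering_sets MCA (zero_MC X))"
  "S1 covers covers \<longleftrightarrow> \<not> Two_wins_G1 (nhds_pt MCA (zero_MC X))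
     (- clustering_sets MCA (zero_MC X))"
proof -
  note Markov = Two_wins_G1_Markov_imp_Two_wins_G1
  show "S1 covers covers \<longleftrightarrow> \<not> One_wins_G1 covers covers"
    using S1_imp_not_One_wins_cover_game not_S1_imp_One_wins_G1 by metis
  show "S1 covers covers \<longleftrightarrow> strong_countable_fan_tightness_at MCA (zero_MC X)"
    "S1 covers covers \<longleftrightarrow> strong_countable_dense_fan_tightness_at MCA (zero_MC X)"
    using S1_imp_strong_countable_fan_tightness strong_countable_fan_tightness_imp_dense
      dense_fan_tightness_imp_S1 by metis+
  show "S1 covers covers \<longleftrightarrow> \<not> Two_wins_G1_Markov (nhds_set X ` \<A>) (- covers)"
    "S1 covers covers \<longleftrightarrow> \<not> Two_wins_G1 (nhds_set X ` \<A>) (- covers)"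
    using S1_imp_not_Two_wins_nhds_set_game not_S1_imp_Two_wins_Markov_nhds_set_game Markov by metis+
  show "S1 covers covers \<longleftrightarrow> \<not> Two_wins_G1_Markov (proper_opens MCA) (closed_discrete_sets MCA)"
    "S1 covers covers \<longleftrightarrow> \<not> Two_wins_G1 (proper_opens MCA) (closed_discrete_sets MCA)"
    using S1_imp_not_Two_wins_open_sets_game not_S1_imp_Two_wins_Markov_open_sets_game Markov
    by metis+
  show "S1 covers covers \<longleftrightarrow> \<not> Two_wins_G1_Markov (nhds_pt MCA (zero_MC X))
     (- clustering_sets MCA (zero_MC X))"
    "S1 covers covers \<longleftrightarrow> \<not> Two_wins_G1 (nhds_pt MCA (zero_MC X))
     (- clustering_sets MCA (zero_MC X))"
    using S1_imp_not_Two_wins_nhds_pt_game not_S1_imp_Two_wins_Markov_nhds_pt_game Markov by metis+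
qed

end

section \<open>Finite powers and the hyperspace of finite sets\<close>

lemma topspace_finite_powers:
  "topspace (finite_powers X) = Sigma {1..} (\<lambda>k. {..<k} \<rightarrow>\<^sub>E topspace X)"
  by (simp add: finite_powers_def comp_def)

lemma openin_finite_powers_slice:
  assumes "openin (finite_powers X) W" "1 \<le> k"
  shows "openin (product_topology (\<lambda>_. X) {..<k}) {p. (k, p) \<in> W}"
  using assms by (simp add: finite_powers_def openin_sum_topology)

text \<open>
  There are finitely many tuples with entries in \<open>F\<close>, and each has a box neighbourhood inside \<open>W\<close>.
  Intersect, for each \<open>x \<in> F\<close>, all sides of these boxes at coordinates with value \<open>x\<close>; a tuple with
  entries in the resulting neighbourhoods of points of \<open>F\<close> lies in one of the boxes.
\<close>

lemma open_cube_around_finite_set: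
  assumes W: "openin (product_topology (\<lambda>_. X) I) W" and I: "finite I"
    and F: "finite F" "F \<subseteq> topspace X" and sub: "(I \<rightarrow>\<^sub>E F) \<subseteq> W"
  obtains U where "openin X U" "F \<subseteq> U" "(I \<rightarrow>\<^sub>E U) \<subseteq> W"
proof -
  have "\<forall>p. \<exists>V. p \<in> (I \<rightarrow>\<^sub>E F) \<longrightarrow> (\<forall>i\<in>I. openin X (V i)) \<and> p \<in> Pi\<^sub>E I V \<and> Pi\<^sub>E I V \<subseteq> W"
  proof (intro allI)
    fix p
    show "\<exists>V. p \<in> (I \<rightarrow>\<^sub>E F) \<longrightarrow> (\<forall>i\<in>I. openin X (V i)) \<and> p \<in> Pi\<^sub>E I V \<and> Pi\<^sub>E I V \<subseteq> W"
    proof (cases "p \<in> (I \<rightarrow>\<^sub>E F)")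
      case True
      then have "p \<in> W" using sub by (rule subsetD[rotated])
      from bspec[OF W[unfolded openin_product_topology_alt] this] show ?thesis by (elim exE) auto
    qed simp
  qed
  then obtain V where "\<forall>p. p \<in> (I \<rightarrow>\<^sub>E F) \<longrightarrow>
      (\<forall>i\<in>I. openin X (V p i)) \<and> p \<in> Pi\<^sub>E I (V p) \<and> Pi\<^sub>E I (V p) \<subseteq> W"
    by (rule choice[THEN exE])
  then have V: "\<And>p i. p \<in> (I \<rightarrow>\<^sub>E F) \<Longrightarrow> i \<in> I \<Longrightarrow> openin X (V p i)"
      "\<And>p. p \<in> (I \<rightarrow>\<^sub>E F) \<Longrightarrow> p \<in> Pi\<^sub>E I (V p)" "\<And>p. p \<in> (I \<rightarrow>\<^sub>E F) \<Longrightarrow> Pi\<^sub>E I (V p) \<subseteq> W"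
    by simp_all
  define S where "S x = {(p, i). p \<in> (I \<rightarrow>\<^sub>E F) \<and> i \<in> I \<and> p i = x}" for x
  define G where "G x = {z \<in> topspace X. \<forall>pi\<in>S x. z \<in> V (fst pi) (snd pi)}" for x
  have "finite (S x)" for x
  proof (rule finite_subset)
    show "S x \<subseteq> (I \<rightarrow>\<^sub>E F) \<times> I" by (auto simp: S_def)
    show "finite ((I \<rightarrow>\<^sub>E F) \<times> I)" using I F by (intro finite_cartesian_product finite_PiE) auto
  qed
  moreover have "openin X {z \<in> topspace X. z \<in> V (fst pi) (snd pi)}" if "pi \<in> S x" for pi x
  proof -
    have op: "openin X (V (fst pi) (snd pi))" using that by (intro V(1)) (auto simp: S_def)
    have "{z \<in> topspace X. z \<in> V (fst pi) (snd pi)} = V (fst pi) (snd pi)"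
      using openin_subset[OF op] by blast
    with op show ?thesis by simp
  qed
  ultimately have G: "openin X (G x)" for x unfolding G_def by (intro openin_Ball_finite)
  show ?thesis
  proof (rule that[of "\<Union>x\<in>F. G x"])
    show "openin X (\<Union>x\<in>F. G x)" using G by blast
    have "x \<in> G x" if x: "x \<in> F" for x
      unfolding G_def
    proof (intro CollectI conjI ballI)
      show "x \<in> topspace X" using x F(2) by blast
      fix pi assume "pi \<in> S x"
      then obtain p i where pi: "pi = (p, i)" "p \<in> (I \<rightarrow>\<^sub>E F)" "i \<in> I" "p i = x"
        unfolding S_def by blast
      have "p i \<in> V p i" using V(2)[OF pi(2)] pi(3) by (rule PiE_mem)
      with pi show "x \<in> V (fst pi) (snd pi)" by simp
    qed
    then show "F \<subseteq> (\<Union>x\<in>F. G x)" by blast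
    show "(I \<rightarrow>\<^sub>E (\<Union>x\<in>F. G x)) \<subseteq> W"
    proof
      fix q assume q: "q \<in> (I \<rightarrow>\<^sub>E (\<Union>x\<in>F. G x))"
      have "\<forall>i\<in>I. \<exists>x. x \<in> F \<and> q i \<in> G x"
      proof
        fix i assume "i \<in> I"
        from PiE_mem[OF q this] show "\<exists>x. x \<in> F \<and> q i \<in> G x" by blast
      qed
      then obtain r where r: "\<forall>i\<in>I. r i \<in> F \<and> q i \<in> G (r i)" by (rule bchoice[THEN exE])
      define p where "p = restrict r I"
      have p: "p \<in> (I \<rightarrow>\<^sub>E F)" using r by (auto simp: p_def)
      have "q i \<in> V p i" if "i \<in> I" for i
      proof -
        have "(p, i) \<in> S (r i)" using p that by (simp add: S_def p_def)
        moreover have "q i \<in> G (r i)" using r that by blast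
        then have "\<forall>pi\<in>S (r i). q i \<in> V (fst pi) (snd pi)" unfolding G_def by blast
        ultimately show ?thesis by (auto dest: bspec)
      qed
      then have "q \<in> Pi\<^sub>E I (V p)" using q by (auto simp: PiE_iff)
      then show "q \<in> W" using V(3)[OF p] by blast
    qed
  qed
qed

lemma Rothberger_continuous_image:
  assumes f: "continuous_map Y Z f" "f ` topspace Y = topspace Z" and Y: "Rothberger Y"
  shows "Rothberger Z"
  unfolding Rothberger_def S1_def
proof (intro allI impI)
  fix \<G> :: "nat \<Rightarrow> 'b set set" assume \<G>: "\<forall>n. \<G> n \<in> open_covers Z"
  define pre where "pre G = {y \<in> topspace Y. f y \<in> G}" for G
  have pre: "openin Y (pre G) \<and> pre G \<noteq> {} \<and> pre G \<noteq> topspace Y" if G: "G \<in> \<G> n" for G n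
  proof (intro conjI)
    have G': "openin Z G" "G \<noteq> {}" "G \<noteq> topspace Z"
      using open_coversD(1)[OF \<G>[rule_format] G] by simp_all
    show "openin Y (pre G)"
      unfolding pre_def using f(1) G'(1) by (rule openin_continuous_map_preimage)
    have "f ` pre G = G" using f(2) openin_subset[OF G'(1)] by (auto simp: pre_def)
    then show "pre G \<noteq> {}" "pre G \<noteq> topspace Y" using G'(2,3) f(2) by auto
  qed
  have "pre ` \<G> n \<in> open_covers Y" for n
  proof -
    have "\<Union>(\<G> n) = topspace Z" using \<G> by (simp add: open_covers_def)
    then have "f y \<in> \<Union>(\<G> n)" if "y \<in> topspace Y" for y
      using imageI[OF that, of f] f(2) by simp
    then have "topspace Y \<subseteq> \<Union>(pre ` \<G> n)" by (force simp: pre_def)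
    with pre show ?thesis by (rule image_in_open_covers)
  qed
  then obtain x where x: "\<forall>n. x n \<in> pre ` \<G> n" "range x \<in> open_covers Y"
    by (rule S1_select[OF Y[unfolded Rothberger_def]])
  from x(1) have "\<forall>n. \<exists>G. G \<in> \<G> n \<and> x n = pre G" by blast
  then obtain G where G: "\<forall>n. G n \<in> \<G> n \<and> x n = pre (G n)" by (rule choice[THEN exE])
  have "topspace Z \<subseteq> \<Union>(range G)"
  proof
    fix z assume "z \<in> topspace Z"
    then obtain y where y: "y \<in> topspace Y" "z = f y" using f(2) by blast
    then obtain n where "y \<in> x n" using open_coversD(2)[OF x(2)] by blast
    then have "z \<in> G n" using G y by (simp add: pre_def)
    then show "z \<in> \<Union>(range G)" by blast
  qed
  moreover have "openin Z (G n) \<and> G n \<noteq> {} \<and> G n \<noteq> topspace Z" for n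
    using open_coversD(1)[OF \<G>[rule_format, of n]] G by blast
  ultimately have "range G \<in> open_covers Z" by (intro image_in_open_covers)
  with G show "\<exists>x. (\<forall>n. x n \<in> \<G> n) \<and> range x \<in> open_covers Z" by blast
qed

context
  fixes X :: "'a topology"
  assumes family: "proper_compact_family X (finite_sets X)"
begin

interpretation proper_compact_family X "finite_sets X" by (rule family)

text \<open>
  Stage \<open>n\<close> uses the covers numbered by the \<open>n\<close>-th row of the pairing function and takes care of the
  powers with exponent at most \<open>n\<close>. A finite set \<open>F\<close> has finitely many tuples of
  these lengths, so members of finitely many covers of the row contain them all, and then contain
  all tuples of these lengths from some open \<open>U\<close> around \<open>F\<close>. A selection that
  swallows every finite set infinitely often does so at stages beyond any given exponent.
\<close>

lemma Rothberger_finite_powers: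
  assumes S1: "S1 (family_covers X (finite_sets X)) (family_covers X (finite_sets X))"
  shows "Rothberger (finite_powers X)"
  unfolding Rothberger_def S1_def
proof (intro allI impI)
  let ?Y = "finite_powers X"
  fix \<G> :: "nat \<Rightarrow> (nat \<times> (nat \<Rightarrow> 'a)) set set" assume \<G>: "\<forall>n. \<G> n \<in> open_covers ?Y"
  have \<G>_open: "openin ?Y G" if "G \<in> \<G> n" for G n using open_coversD(1)[OF \<G>[rule_format] that] by simp
  have \<G>_cover: "\<exists>G\<in>\<G> n. y \<in> G" if "y \<in> topspace ?Y" for y n
    using open_coversD(2)[OF \<G>[rule_format, of n]] that by blast
  obtain x0 where "x0 \<in> topspace X" using nonempty by blast
  then have "(1, restrict (\<lambda>_. x0) {..<1}) \<in> topspace ?Y" by (auto simp: topspace_finite_powers)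
  then have \<G>_ne: "\<exists>G. G \<in> \<G> n" for n using \<G>_cover by blast
  \<comment> \<open>the members \<open>v j\<close> of the covers in row \<open>n\<close> contain the \<open>k\<close>-tuples from \<open>U\<close> for \<open>1 \<le> k \<le> n\<close>\<close>
  define good where "good n U v \<longleftrightarrow> (\<forall>j. v j \<in> \<G> (prod_encode (n, j))) \<and>
      (\<forall>k\<in>{1..n}. \<forall>p \<in> {..<k} \<rightarrow>\<^sub>E U. (k, p) \<in> (\<Union>j. v j))" for n and U :: "'a set" and v
  have stage: "\<exists>U\<in>{U. openin X U \<and> (\<exists>v. good n U v)}. F \<subseteq> U" if F: "F \<in> finite_sets X" for n F
  proof -
    define P where "P = Sigma {1..n} (\<lambda>k. {..<k} \<rightarrow>\<^sub>E F)"
    have "finite P" using F unfolding P_def by (intro finite_SigmaI finite_PiE) (auto simp: finite_sets_def)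
    have PY: "P \<subseteq> topspace ?Y" using F by (auto simp: P_def topspace_finite_powers finite_sets_def PiE_iff)
    \<comment> \<open>the cover numbered \<open>h p\<close> within the row is responsible for the tuple \<open>p\<close>\<close>
    obtain h :: "nat \<times> (nat \<Rightarrow> 'a) \<Rightarrow> nat" where h: "inj_on h P"
      using finite_imp_inj_to_nat_seg[OF \<open>finite P\<close>] by blast
    have "\<exists>G. G \<in> \<G> (prod_encode (n, j)) \<and> (\<forall>p\<in>P. h p = j \<longrightarrow> p \<in> G)" for j
    proof (cases "\<exists>p\<in>P. h p = j")
      case True
      then obtain p where p: "p \<in> P" "h p = j" by blast
      then obtain G where "G \<in> \<G> (prod_encode (n, j))" "p \<in> G" using \<G>_cover PY by blast
      moreover have "q = p" if "q \<in> P" "h q = j" for q using h p that by (auto simp: inj_on_def)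
      ultimately show ?thesis by blast
    next
      case False
      then show ?thesis using \<G>_ne by blast
    qed
    then have "\<forall>j. \<exists>G. G \<in> \<G> (prod_encode (n, j)) \<and> (\<forall>p\<in>P. h p = j \<longrightarrow> p \<in> G)" by blast
    then obtain v where v: "\<forall>j. v j \<in> \<G> (prod_encode (n, j)) \<and> (\<forall>p\<in>P. h p = j \<longrightarrow> p \<in> v j)"
      by (rule choice[THEN exE])
    define W where "W = (\<Union>j. v j)"
    have W: "openin ?Y W" unfolding W_def using v \<G>_open by blast
    have PW: "P \<subseteq> W" using v unfolding W_def by blast
    have "\<exists>U. openin X U \<and> F \<subseteq> U \<and> ({..<k} \<rightarrow>\<^sub>E U) \<subseteq> {p. (k, p) \<in> W}" if k: "k \<in> {1..n}" for k
    proof -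
      have slice: "openin (product_topology (\<lambda>_. X) {..<k}) {p. (k, p) \<in> W}"
        using W k by (intro openin_finite_powers_slice) auto
      have cube: "({..<k} \<rightarrow>\<^sub>E F) \<subseteq> {p. (k, p) \<in> W}" using PW k by (auto simp: P_def)
      have "finite F" "F \<subseteq> topspace X" using F by (auto simp: finite_sets_def)
      then obtain U where "openin X U" "F \<subseteq> U" "({..<k} \<rightarrow>\<^sub>E U) \<subseteq> {p. (k, p) \<in> W}"
        by (rule open_cube_around_finite_set[OF slice finite_lessThan _ _ cube])
      then show ?thesis by (intro exI conjI)
    qed
    then have "\<forall>k\<in>{1..n}. \<exists>U. openin X U \<and> F \<subseteq> U \<and> ({..<k} \<rightarrow>\<^sub>E U) \<subseteq> {p. (k, p) \<in> W}"
      by (rule ballI)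
    then obtain U where "\<forall>k\<in>{1..n}. openin X (U k) \<and> F \<subseteq> U k \<and>
        ({..<k} \<rightarrow>\<^sub>E U k) \<subseteq> {p. (k, p) \<in> W}"
      by (rule bchoice[THEN exE])
    then have U: "\<And>k. k \<in> {1..n} \<Longrightarrow> openin X (U k)" "\<And>k. k \<in> {1..n} \<Longrightarrow> F \<subseteq> U k"
        "\<And>k. k \<in> {1..n} \<Longrightarrow> ({..<k} \<rightarrow>\<^sub>E U k) \<subseteq> {p. (k, p) \<in> W}"
      by simp_all
    define V where "V = {z \<in> topspace X. \<forall>k\<in>{1..n}. z \<in> U k}"
    have "openin X V" unfolding V_def
    proof (rule openin_Ball_finite)
      fix k assume "k \<in> {1..n}"
      then have "{z \<in> topspace X. z \<in> U k} = U k" using openin_subset[OF U(1)] by blast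
      then show "openin X {z \<in> topspace X. z \<in> U k}" using U(1)[OF \<open>k \<in> {1..n}\<close>] by simp
    qed simp
    moreover have "F \<subseteq> V"
    proof
      fix z assume z: "z \<in> F"
      then have "\<forall>k\<in>{1..n}. z \<in> U k" using U(2) by blast
      moreover have "z \<in> topspace X" using z F by (auto simp: finite_sets_def)
      ultimately show "z \<in> V" by (simp add: V_def)
    qed
    moreover have "good n V v"
      unfolding good_def
    proof (intro conjI allI ballI)
      show "v j \<in> \<G> (prod_encode (n, j))" for j using v by blast
      fix k p assume k: "k \<in> {1..n}" and p: "p \<in> {..<k} \<rightarrow>\<^sub>E V"
      have "V \<subseteq> U k" using k by (auto simp: V_def)
      then have "p \<in> {..<k} \<rightarrow>\<^sub>E U k" using p PiE_mono[of "{..<k}" "\<lambda>_. V" "\<lambda>_. U k"] by blast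
      then show "(k, p) \<in> (\<Union>j. v j)" using U(3)[OF k] unfolding W_def by blast
    qed
    ultimately show ?thesis by blast
  qed
  obtain g where g: "\<And>n. g n \<in> {U. openin X U \<and> (\<exists>v. good n U v)}"
      "\<And>F. F \<in> finite_sets X \<Longrightarrow> infinite {n. F \<subseteq> g n}"
  proof (rule S1_family_covers_beats_game[OF S1,
        of "\<lambda>s. {U. openin X U \<and> (\<exists>v. good (length s) U v)}" "\<lambda>_ U. U"])
    fix g assume "\<And>n. g n \<in> {U. openin X U \<and> (\<exists>v. good (length (map g [0..<n])) U v)}"
      and "\<And>F. F \<in> finite_sets X \<Longrightarrow> infinite {n. F \<subseteq> g n}"
    then show ?thesis by (intro that[of g]) auto
  qed (use stage in auto)
  have "\<forall>n. \<exists>v. good n (g n) v" using g(1) by blast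
  then obtain v where v: "\<forall>n. good n (g n) (v n)" by (rule choice[THEN exE])
  define x where "x m = v (fst (prod_decode m)) (snd (prod_decode m))" for m
  have x: "x m \<in> \<G> m" for m
  proof -
    have "v n j \<in> \<G> (prod_encode (n, j))" for n j using v by (simp add: good_def)
    from this[of "fst (prod_decode m)" "snd (prod_decode m)"] show ?thesis by (simp add: x_def)
  qed
  have "topspace ?Y \<subseteq> \<Union>(range x)"
  proof
    fix y assume "y \<in> topspace ?Y"
    then obtain k p where y: "y = (k, p)" "1 \<le> k" "p \<in> {..<k} \<rightarrow>\<^sub>E topspace X"
      by (auto simp: topspace_finite_powers)
    then have "p ` {..<k} \<in> finite_sets X"
      by (auto simp: finite_sets_def PiE_iff lessThan_empty_iff)
    then obtain n where n: "k \<le> n" "p ` {..<k} \<subseteq> g n"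
      using g(2) unfolding infinite_nat_iff_unbounded_le by blast
    then have "p \<in> {..<k} \<rightarrow>\<^sub>E g n" using y(3) by (auto simp: PiE_iff)
    then have "(k, p) \<in> (\<Union>j. v n j)" using v[rule_format, of n] n(1) y(2) by (simp add: good_def)
    then obtain j where "(k, p) \<in> v n j" by blast
    then have "y \<in> x (prod_encode (n, j))" by (simp add: x_def y(1))
    then show "y \<in> \<Union>(range x)" by blast
  qed
  moreover have "openin ?Y (x m) \<and> x m \<noteq> {} \<and> x m \<noteq> topspace ?Y" for m
    using open_coversD(1)[OF \<G>[rule_format, of m] x[of m]] .
  ultimately have "range x \<in> open_covers ?Y" by (intro image_in_open_covers)
  with x show "\<exists>x. (\<forall>n. x n \<in> \<G> n) \<and> range x \<in> open_covers ?Y" by blast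
qed

lemma finite_sets_subset_compact_sets: "finite_sets X \<subseteq> compact_sets X"
  using compact_member nonempty_member by (auto simp: compact_sets_def)

lemma topspace_P_fin: "topspace (P_fin X) = finite_sets X"
  using finite_sets_subset_compact_sets by (auto simp: P_fin_def topspace_Vietoris)

lemma continuous_map_finite_powers_P_fin:
  "continuous_map (finite_powers X) (P_fin X) (\<lambda>(k, p). p ` {..<k})"
proof -
  let ?f = "\<lambda>(k, p :: nat \<Rightarrow> 'a). p ` {..<k}"
  have fin: "?f y \<in> finite_sets X" if "y \<in> topspace (finite_powers X)" for y
    using that by (auto simp: topspace_finite_powers finite_sets_def PiE_iff lessThan_empty_iff)
  then have comp: "?f y \<in> compact_sets X" if "y \<in> topspace (finite_powers X)" for y
    using that finite_sets_subset_compact_sets by blast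
  have slices: "openin (finite_powers X) S"
    if "S \<subseteq> topspace (finite_powers X)"
      "\<And>k. 1 \<le> k \<Longrightarrow> openin (product_topology (\<lambda>_. X) {..<k}) {p. (k, p) \<in> S}" for S
    using that topspace_sum_topology[of "\<lambda>n. product_topology (\<lambda>_. X) {..<n}" "{1..}"]
    unfolding finite_powers_def openin_sum_topology by auto
  have slice: "{p. (k, p) \<in> ?f -` T \<inter> topspace (finite_powers X)} =
      {p \<in> {..<k} \<rightarrow>\<^sub>E topspace X. p ` {..<k} \<in> T}" if "1 \<le> k" for k T
    using that by (simp add: topspace_finite_powers conj_commute)
  have comp_slice: "p ` {..<k} \<in> compact_sets X" if "1 \<le> k" "p \<in> {..<k} \<rightarrow>\<^sub>E topspace X"
    for k :: nat and p
    using comp[of "(k, p)"] that by (simp add: topspace_finite_powers)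
  have "continuous_map (finite_powers X) (Vietoris X) ?f"
    unfolding Vietoris_def
  proof (rule continuous_on_generated_topo)
    fix T assume "T \<in> {{K \<in> compact_sets X. K \<subseteq> U} |U. openin X U} \<union>
      {{K \<in> compact_sets X. K \<inter> U \<noteq> {}} |U. openin X U}"
    then consider U where "openin X U" "T = {K \<in> compact_sets X. K \<subseteq> U}"
      | U where "openin X U" "T = {K \<in> compact_sets X. K \<inter> U \<noteq> {}}" by blast
    then show "openin (finite_powers X) (?f -` T \<inter> topspace (finite_powers X))"
    proof cases
      case 1
      show ?thesis
      proof (rule slices)
        fix k :: nat assume k: "1 \<le> k"
        have "{p \<in> {..<k} \<rightarrow>\<^sub>E topspace X. p ` {..<k} \<in> T} =
            {p \<in> {..<k} \<rightarrow>\<^sub>E topspace X. p ` {..<k} \<subseteq> U}"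
          by (rule Collect_cong) (simp add: 1(2) comp_slice[OF k] cong: conj_cong)
        also have "\<dots> = ({..<k} \<rightarrow>\<^sub>E U)"
          using openin_subset[OF 1(1)] by (intro set_eqI) (simp add: PiE_iff image_subset_iff, blast)
        finally have "{p. (k, p) \<in> ?f -` T \<inter> topspace (finite_powers X)} = ({..<k} \<rightarrow>\<^sub>E U)"
          by (simp only: slice[OF k])
        then show "openin (product_topology (\<lambda>_. X) {..<k})
            {p. (k, p) \<in> ?f -` T \<inter> topspace (finite_powers X)}"
          using 1(1) by (simp add: openin_PiE)
      qed simp
    next
      case 2
      show ?thesis
      proof (rule slices)
        fix k :: nat assume k: "1 \<le> k"
        have "{p \<in> {..<k} \<rightarrow>\<^sub>E topspace X. p ` {..<k} \<in> T} =
            {p \<in> {..<k} \<rightarrow>\<^sub>E topspace X. p ` {..<k} \<inter> U \<noteq> {}}"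
          by (rule Collect_cong) (simp add: 2(2) comp_slice[OF k] cong: conj_cong)
        also have "\<dots> = (\<Union>i\<in>{..<k}. {p \<in> topspace (product_topology (\<lambda>_. X) {..<k}). p i \<in> U})"
          by auto
        finally have "{p. (k, p) \<in> ?f -` T \<inter> topspace (finite_powers X)} =
            (\<Union>i\<in>{..<k}. {p \<in> topspace (product_topology (\<lambda>_. X) {..<k}). p i \<in> U})"
          by (simp only: slice[OF k])
        moreover have "openin (product_topology (\<lambda>_. X) {..<k})
            {p \<in> topspace (product_topology (\<lambda>_. X) {..<k}). p i \<in> U}" if "i \<in> {..<k}" for i
          using continuous_map_product_projection[OF that] 2(1)
          by (rule openin_continuous_map_preimage)
        ultimately show "openin (product_topology (\<lambda>_. X) {..<k})
            {p. (k, p) \<in> ?f -` T \<inter> topspace (finite_powers X)}"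
          by auto
      qed simp
    qed
  next
    show "?f ` topspace (finite_powers X) \<subseteq> \<Union>({{K \<in> compact_sets X. K \<subseteq> U} |U. openin X U} \<union>
      {{K \<in> compact_sets X. K \<inter> U \<noteq> {}} |U. openin X U})"
      using comp topspace_Vietoris[of X]
      unfolding Vietoris_def topology_generated_by_topspace by (simp add: image_subset_iff)
  qed
  then show ?thesis
    unfolding P_fin_def continuous_map_in_subtopology using fin by blast
qed

lemma finite_powers_onto_P_fin:
  "(\<lambda>(k, p). p ` {..<k}) ` topspace (finite_powers X) = topspace (P_fin X)"
proof
  show "(\<lambda>(k, p). p ` {..<k}) ` topspace (finite_powers X) \<subseteq> topspace (P_fin X)"
    by (auto simp: topspace_P_fin topspace_finite_powers finite_sets_def PiE_iff lessThan_empty_iff)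
  show "topspace (P_fin X) \<subseteq> (\<lambda>(k, p). p ` {..<k}) ` topspace (finite_powers X)"
  proof
    fix F assume "F \<in> topspace (P_fin X)"
    then have F: "finite F" "F \<noteq> {}" "F \<subseteq> topspace X" by (auto simp: topspace_P_fin finite_sets_def)
    obtain h where "bij_betw h {0..<card F} F" using ex_bij_betw_nat_finite[OF F(1)] by blast
    then have h: "h ` {..<card F} = F" by (simp add: bij_betw_def lessThan_atLeast0)
    have "1 \<le> card F" using F by (simp add: Suc_le_eq card_gt_0_iff)
    then have "(card F, restrict h {..<card F}) \<in> topspace (finite_powers X)"
      using h F(3) by (auto simp: topspace_finite_powers)
    moreover have "F = (\<lambda>(k, p). p ` {..<k}) (card F, restrict h {..<card F})" using h by simp
    ultimately show "F \<in> (\<lambda>(k, p). p ` {..<k}) ` topspace (finite_powers X)" by (rule rev_image_eqI)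
  qed
qed

text \<open>
  The finite sets contained in a member of an \<open>\<omega>\<close>-cover form an open set of the hyperspace, and
  these open sets are proper because they do not contain the singletons outside of the member.
\<close>

lemma Rothberger_P_fin_imp_S1:
  assumes R: "Rothberger (P_fin X)"
  shows "S1 (family_covers X (finite_sets X)) (family_covers X (finite_sets X))"
  unfolding S1_def
proof (intro allI impI)
  fix \<U> :: "nat \<Rightarrow> 'a set set" assume \<U>: "\<forall>n. \<U> n \<in> family_covers X (finite_sets X)"
  define cone where "cone U = {F \<in> finite_sets X. F \<subseteq> U}" for U
  have "cone ` \<U> n \<in> open_covers (P_fin X)" for n
  proof -
    note cov = family_coversD[OF \<U>[rule_format, of n]]
    have "openin (P_fin X) (cone U) \<and> cone U \<noteq> {} \<and> cone U \<noteq> topspace (P_fin X)"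
      if "U \<in> \<U> n" for U
    proof (intro conjI)
      have U: "openin X U" "U \<noteq> {}" "U \<noteq> topspace X" using cov(1)[OF that] by (auto simp: proper_opens_def)
      have "openin (Vietoris X) {K \<in> compact_sets X. K \<subseteq> U}"
        unfolding Vietoris_def using U(1) by (intro topology_generated_by_Basis) blast
      moreover have "cone U = {K \<in> compact_sets X. K \<subseteq> U} \<inter> finite_sets X"
        using finite_sets_subset_compact_sets by (auto simp: cone_def)
      ultimately show "openin (P_fin X) (cone U)" unfolding P_fin_def openin_subtopology by blast
      obtain x where "x \<in> U" using U(2) by blast
      moreover from this have "x \<in> topspace X" using openin_subset[OF U(1)] by blast
      ultimately have "{x} \<in> cone U" using singleton_member by (simp add: cone_def)
      then show "cone U \<noteq> {}" by blast
      obtain y where "y \<in> topspace X" "y \<notin> U" using U(3) openin_subset[OF U(1)] by blast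
      then have "{y} \<in> finite_sets X" "{y} \<notin> cone U" using singleton_member by (auto simp: cone_def)
      then show "cone U \<noteq> topspace (P_fin X)" unfolding topspace_P_fin by blast
    qed
    moreover have "topspace (P_fin X) \<subseteq> \<Union>(cone ` \<U> n)"
      using cov(2) by (auto simp: topspace_P_fin cone_def)
    ultimately show ?thesis by (rule image_in_open_covers)
  qed
  then obtain x where x: "\<forall>n. x n \<in> cone ` \<U> n" "range x \<in> open_covers (P_fin X)"
    by (rule S1_select[OF R[unfolded Rothberger_def]])
  from x(1) have "\<forall>n. \<exists>U. U \<in> \<U> n \<and> x n = cone U" by blast
  then obtain U where U: "\<forall>n. U n \<in> \<U> n \<and> x n = cone (U n)" by (rule choice[THEN exE])
  have "range U \<in> family_covers X (finite_sets X)"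
  proof (rule range_in_family_covers)
    show "U n \<in> proper_opens X" for n using family_coversD(1)[OF \<U>[rule_format]] U by blast
    show "\<exists>n. F \<subseteq> U n" if "F \<in> finite_sets X" for F
    proof -
      have "F \<in> \<Union>(range x)" using x(2) that by (simp add: open_covers_def topspace_P_fin)
      then obtain n where "F \<in> x n" by blast
      then have "F \<subseteq> U n" using U by (simp add: cone_def)
      then show ?thesis ..
    qed
  qed
  with U show "\<exists>x. (\<forall>n. x n \<in> \<U> n) \<and> range x \<in> family_covers X (finite_sets X)" by blast
qed

end

text \<open>
  The finite sets and the compact sets that a cover has to swallow include the empty set, while
  the families of neighbourhoods are indexed by non-empty sets.
\<close>

lemma family_covers_remove_empty:
  assumes "topspace X \<noteq> {}"
  shows "family_covers X (\<A> - {{}}) = family_covers X \<A>"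
proof -
  have "(\<forall>A\<in>\<A>. \<exists>U\<in>\<U>. A \<subseteq> U) \<longleftrightarrow> (\<forall>A\<in>\<A> - {{}}. \<exists>U\<in>\<U>. A \<subseteq> U)"
    if \<U>: "\<U> \<in> open_covers X" for \<U>
  proof -
    have "\<U> \<noteq> {}" using open_coversD(2)[OF \<U>] assms by blast
    then show ?thesis by blast
  qed
  then show ?thesis unfolding family_covers_def by (intro Collect_cong) blast
qed

lemma omega_covers_eq_family_covers:
  assumes "topspace X \<noteq> {}"
  shows "omega_covers X = family_covers X (finite_sets X)"
proof -
  have "finite_sets X = {F. F \<subseteq> topspace X \<and> finite F} - {{}}" by (auto simp: finite_sets_def)
  moreover have "omega_covers X = family_covers X {F. F \<subseteq> topspace X \<and> finite F}"
    by (simp add: omega_covers_def family_covers_def)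
  ultimately show ?thesis using family_covers_remove_empty[OF assms] by simp
qed

lemma k_covers_eq_family_covers:
  assumes "topspace X \<noteq> {}"
  shows "k_covers X = family_covers X (compact_sets X)"
proof -
  have "compact_sets X = {K. compactin X K} - {{}}" by (auto simp: compact_sets_def)
  moreover have "k_covers X = family_covers X {K. compactin X K}"
    by (simp add: k_covers_def family_covers_def)
  ultimately show ?thesis using family_covers_remove_empty[OF assms] by simp
qed

lemma proper_compact_family_finite_sets:
  assumes "regular_space X" "Hausdorff_space X" "infinite (topspace X)"
  shows "proper_compact_family X (finite_sets X)"
  using assms by unfold_locales (auto simp: finite_sets_def finite_imp_compactin)

lemma proper_compact_family_compact_sets:
  assumes "regular_space X" "Hausdorff_space X" "\<not> compact_space X"
  shows "proper_compact_family X (compact_sets X)"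
proof unfold_locales
  show "topspace X \<noteq> {}" using assms(3) by (metis compact_space_def compactin_empty)
qed (use assms in \<open>auto simp: compact_sets_def compact_space_def compactin_Un\<close>)

theorem corollary46:
  fixes X :: "'a topology"
  assumes "regular_space X" and "Hausdorff_space X"
  shows
    "(infinite (topspace X) \<longrightarrow>
        (omega_Rothberger X \<longleftrightarrow> Rothberger (finite_powers X)) \<and>
        (omega_Rothberger X \<longleftrightarrow> Rothberger (P_fin X)) \<and>
        (omega_Rothberger X \<longleftrightarrow> \<not> One_wins_G1 (omega_covers X) (omega_covers X)) \<and>
        (omega_Rothberger X \<longleftrightarrow> strong_countable_fan_tightness_at (MC_p X) (zero_MC X)) \<and>
        (omega_Rothberger X \<longleftrightarrow> strong_countable_dense_fan_tightness_at (MC_p X) (zero_MC X)) \<and>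
        (omega_Rothberger X \<longleftrightarrow>
           \<not> Two_wins_G1_Markov (nhds_set X ` finite_sets X) (- omega_covers X)) \<and>
        (omega_Rothberger X \<longleftrightarrow>
           \<not> Two_wins_G1 (nhds_set X ` finite_sets X) (- omega_covers X)) \<and>
        (omega_Rothberger X \<longleftrightarrow>
           \<not> Two_wins_G1_Markov (proper_opens (MC_p X)) (closed_discrete_sets (MC_p X))) \<and>
        (omega_Rothberger X \<longleftrightarrow>
           \<not> Two_wins_G1 (proper_opens (MC_p X)) (closed_discrete_sets (MC_p X))) \<and>
        (omega_Rothberger X \<longleftrightarrow>
           \<not> Two_wins_G1_Markov (nhds_pt (MC_p X) (zero_MC X))
                (- clustering_sets (MC_p X) (zero_MC X))) \<and>
        (omega_Rothberger X \<longleftrightarrow>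
           \<not> Two_wins_G1 (nhds_pt (MC_p X) (zero_MC X))
                (- clustering_sets (MC_p X) (zero_MC X))))
     \<and>
     (\<not> compact_space X \<longrightarrow>
        (k_Rothberger X \<longleftrightarrow> \<not> One_wins_G1 (k_covers X) (k_covers X)) \<and>
        (k_Rothberger X \<longleftrightarrow> strong_countable_fan_tightness_at (MC_k X) (zero_MC X)) \<and>
        (k_Rothberger X \<longleftrightarrow> strong_countable_dense_fan_tightness_at (MC_k X) (zero_MC X)) \<and>
        (k_Rothberger X \<longleftrightarrow>
           \<not> Two_wins_G1_Markov (nhds_set X ` compact_sets X) (- k_covers X)) \<and>
        (k_Rothberger X \<longleftrightarrow>
           \<not> Two_wins_G1 (nhds_set X ` compact_sets X) (- k_covers X)) \<and>
        (k_Rothberger X \<longleftrightarrow>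
           \<not> Two_wins_G1_Markov (proper_opens (MC_k X)) (closed_discrete_sets (MC_k X))) \<and>
        (k_Rothberger X \<longleftrightarrow>
           \<not> Two_wins_G1 (proper_opens (MC_k X)) (closed_discrete_sets (MC_k X))) \<and>
        (k_Rothberger X \<longleftrightarrow>
           \<not> Two_wins_G1_Markov (nhds_pt (MC_k X) (zero_MC X))
                (- clustering_sets (MC_k X) (zero_MC X))) \<and>
        (k_Rothberger X \<longleftrightarrow>
           \<not> Two_wins_G1 (nhds_pt (MC_k X) (zero_MC X))
                (- clustering_sets (MC_k X) (zero_MC X))))"
proof ((rule conjI; rule impI), goal_cases)
  case 1
  then have family: "proper_compact_family X (finite_sets X)"
    using assms by (intro proper_compact_family_finite_sets)
  have eq: "omega_covers X = family_covers X (finite_sets X)"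
    using proper_compact_family.nonempty[OF family] by (rule omega_covers_eq_family_covers)
  have "Rothberger (P_fin X)" if "Rothberger (finite_powers X)"
    by (rule Rothberger_continuous_image[OF continuous_map_finite_powers_P_fin[OF family]
          finite_powers_onto_P_fin[OF family] that])
  then have powers:
      "S1 (family_covers X (finite_sets X)) (family_covers X (finite_sets X)) \<longleftrightarrow>
         Rothberger (finite_powers X)"
      "S1 (family_covers X (finite_sets X)) (family_covers X (finite_sets X)) \<longleftrightarrow>
         Rothberger (P_fin X)"
    using Rothberger_finite_powers[OF family] Rothberger_P_fin_imp_S1[OF family] by blast+
  show ?case
    unfolding omega_Rothberger_def eq MC_p_def
    by (intro conjI; fact powers proper_compact_family.S1_family_covers_equivalences[OF family])
next
  case 2
  then have family: "proper_compact_family X (compact_sets X)"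
    using assms by (intro proper_compact_family_compact_sets)
  have eq: "k_covers X = family_covers X (compact_sets X)"
    using proper_compact_family.nonempty[OF family] by (rule k_covers_eq_family_covers)
  show ?case
    unfolding k_Rothberger_def eq MC_k_def
    by (intro conjI; fact proper_compact_family.S1_family_covers_equivalences[OF family])
qed

end
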